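(* Let $K\subset\mathbb{R}^n$ be a convex body containing the origin and let $\mu$ be a measure on $\mathbb{R}^n$ given by $d\mu(x)=\phi(x)\,dx$, where $\phi:\mathbb{R}^n\to[0,\infty)$ is radially decreasing. Then $$\text{(1)}\quad\int_0^1\mu\bigl((1-\theta)K+\theta(-K)\bigr)\,d\theta\le\frac{2^n}{n+1}\sup_{y\in K,\ \theta\in(0,1]}\frac{\mu\bigl((1-\theta)y-\theta K\bigr)}{\theta^n}$$ and $$\text{(2)}\quad\mu\Bigl(\mathrm{conv}\bigl(K\cup(-K)\bigr)\Bigr)\le2^n\sup_{y\in K,\ \theta\in(0,1]}\frac{\mu\bigl((1-\theta)y-\theta K\bigr)}{\theta^n}.$$ Moreover, if $\phi$ is continuous at the origin, then equality holds in (1) if and only if $\mu$ is a constant multiple of the Lebesgue measure on $\mathrm{conv}(K\cup(-K))$ and $K$ is a simplex, and equality holds in (2) if and only if $\mu$ is a constant multiple of the Lebesgue measure on $\mathrm{conv}(K\cup(-K))$ and $K$ is a simplex with the origin as a vertex.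
   Context: A convex body in $\mathbb{R}^n$ is a compact convex set with non-empty interior. Sums of sets are Minkowski sums. $\mathrm{conv}$ is the convex hull and $\mathrm{vol}$ is $n$-dimensional Lebesgue measure. A function $\phi:\mathbb{R}^n\to[0,\infty)$ is radially decreasing if $\phi(tx)\ge\phi(x)$ for all $t\in[0,1]$ and $x\in\mathbb{R}^n$. "$\mu$ is a constant multiple of the Lebesgue measure on $A$" means that there is a constant $c\ge0$ with $\mu(M)=c\,\mathrm{vol}(M)$ for all measurable $M\subset A$.
   Formalization: The equality characterizations additionally assume that φ is not identically zero; for φ = 0 both sides of (1) and (2) vanish for every convex body K, so equality would also hold when K is not a simplex. *)

theory Defs
  imports "HOL-Analysis.Analysis"
begin

definition convex_body :: "(real ^ 'n) set \<Rightarrow> bool" where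
  "convex_body K \<longleftrightarrow> compact K \<and> convex K \<and> interior K \<noteq> {}"

definition radially_decreasing :: "(real ^ 'n \<Rightarrow> real) \<Rightarrow> bool" where
  "radially_decreasing \<phi> \<longleftrightarrow> (\<forall>t\<in>{0..1}. \<forall>x. \<phi> (t *\<^sub>R x) \<ge> \<phi> x)"

definition const_multiple_lebesgue_on ::
    "(real ^ 'n) measure \<Rightarrow> (real ^ 'n) set \<Rightarrow> bool" where
  "const_multiple_lebesgue_on \<mu> A \<longleftrightarrow>
     (\<exists>c::real. c \<ge> 0 \<and>
        (\<forall>M\<in>sets lebesgue. M \<subseteq> A \<longrightarrow> emeasure \<mu> M = ennreal c * emeasure lebesgue M))"

text \<open>On sets, unary minus is the complement, so the reflection \<open>-K\<close> is \<open>uminus ` K\<close>;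
  \<open>+\<close> is the Minkowski sum of \<open>HOL-Library.Set_Algebras\<close>.\<close>

definition minkowski_comb :: "real \<Rightarrow> (real ^ 'n) set \<Rightarrow> (real ^ 'n) set" where
  "minkowski_comb \<theta> K = (\<lambda>x. (1 - \<theta>) *\<^sub>R x) ` K + (\<lambda>x. \<theta> *\<^sub>R x) ` (uminus ` K)"

text \<open>The supremum on the right-hand side of both inequalities; the image is the set
  \<open>(1 - \<theta>)y - \<theta>K\<close>.\<close>

definition sup_ratio :: "(real ^ 'n) measure \<Rightarrow> (real ^ 'n) set \<Rightarrow> ennreal" where
  "sup_ratio \<mu> K =
     (SUP (y, \<theta>) \<in> K \<times> {0<..1}.
        emeasure \<mu> ((\<lambda>x. (1 - \<theta>) *\<^sub>R y - \<theta> *\<^sub>R x) ` K) / ennreal (\<theta> ^ CARD('n)))"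

end

theory Submission imports Defs begin

text \<open>
  Attach to every point \<open>(x, t)\<close> of \<open>\<real>\<^sup>n \<times> \<real>\<close> the intersection \<open>O(x, t)\<close> of \<open>(1/2 - t)K\<close> with
  the translate \<open>x + (1/2 + t)K\<close>. The points with \<open>O(x, t) \<noteq> {}\<close> form an \<open>(n+1)\<close>-dimensional
  convex body \<open>C\<close> whose slice at height \<open>t = \<theta> - 1/2\<close> is \<open>(1 - \<theta>)K + \<theta>(-K)\<close>, so the left-hand
  side of the first inequality is the mass of \<open>C\<close> under \<open>\<nu> = \<mu> \<times> dt\<close>. The whole argument is a
  two-sided estimate of the \<open>\<nu>\<close>-integral of \<open>vol O\<close>.

  From above: by Fubini, the integral over the slice at height \<open>t\<close> is the integral over
  \<open>y \<in> (1 - \<theta>)K\<close> of \<open>\<mu>(y - \<theta>K)\<close>. The supremum \<open>S\<close> of the theorem bounds each \<open>\<mu>(y - \<theta>K)\<close> by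
  \<open>S \<theta>\<^sup>n\<close>, and a Beta integral remains.

  From below: \<open>O(0, 0) = K/2\<close>, and by convexity \<open>O(sw)\<close> contains a translate of \<open>((1 - s)/2)K\<close> for
  \<open>w \<in> C\<close>. Hence \<open>vol O\<close> is at least \<open>(1 - s)\<^sup>n vol O(0)\<close> on \<open>sC\<close>, while
  \<open>\<nu>(sC) \<ge> s\<^sup>n\<^sup>+\<^sup>1 \<nu>(C)\<close> because the density decreases along rays. Integrating over the levels
  of \<open>vol O\<close> (lemma \<open>nn_integral_ge_of_concentric_minorant\<close>) gives a multiple of \<open>\<nu>(C)\<close>, again
  with a Beta integral as the factor. The quotient of the two Beta integrals is \<open>1/(n+1)\<close>, and
  \<open>2\<^sup>n\<close> is \<open>vol K / vol (K/2)\<close>.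

  The second inequality applies the same layer-cake lemma to the length of the fibres of \<open>C\<close> over
  \<open>conv(K \<union> -K)\<close>: the fibre over the origin has length \<open>1\<close>, so the fibre over \<open>sx\<close> has length at
  least \<open>1 - s\<close>, and \<open>\<mu>(conv(K \<union> -K)) \<le> (n+1) \<nu>(C)\<close>.

  For the equality cases let \<open>\<phi>\<close> be continuous at the origin. Shrinking copies of \<open>-K\<close> towards the
  origin shows \<open>S = \<phi>(0) vol K\<close>, and \<open>\<phi> \<le> \<phi>(0)\<close>, so equality splits into \<open>\<phi> = \<phi>(0)\<close> almost
  everywhere on \<open>conv(K \<union> -K)\<close> and equality for Lebesgue measure. The latter forces \<open>O(sw)\<close> to be
  exactly a translate of \<open>((1 - s)/2)K\<close> for all \<open>w\<close> on the boundary of \<open>C\<close>. Read in the cone over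
  \<open>K\<close>, this says that the cone \<open>Q\<close> satisfies \<open>Q \<inter> (Q + p) = Q + q\<close> for every \<open>p\<close> and a suitable
  \<open>q\<close>, that is, \<open>Q\<close> orders \<open>\<real>\<^sup>n \<times> \<real>\<close> as a lattice (lemma \<open>cone_join_of_equality\<close>). By Riesz
  decomposition, a lattice cone has linearly independent extreme rays, so the extreme points of \<open>K\<close>
  are affinely independent and \<open>K\<close> is a simplex (lemma \<open>simplex_of_cone_joins\<close>).
  Conversely, in barycentric coordinates the overlaps of a simplex are homothets whose size is affine
  along rays from the origin, which turns the lower estimate into an equality
  (lemma \<open>rs_body_volume_simplex\<close>).
  In the second inequality, if the origin is not a vertex, then \<open>K\<close> contains a segment around it,
  above which the fibres of \<open>C\<close> have full length, so the fibre estimate is strict; for a simplex with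
  vertex \<open>0\<close> the fibre length is exactly \<open>1\<close> minus a gauge.
\<close>

section \<open>Layer-cake integrals and concentric level sets\<close>

lemma nn_integral_beta_nat:
  fixes a b :: nat
  shows "(\<integral>\<^sup>+v. ennreal (v ^ a * (1 - v) ^ b) * indicator {0..1} v \<partial>lborel)
           = ennreal (fact a * fact b / fact (a + b + 1))"
proof -
  have "((\<lambda>t::real. t powr (real (a+1) - 1) * (1 - t) powr (real (b+1) - 1)) has_integral
          Beta (real (a+1)) (real (b+1))) {0..1}"
    by (rule has_integral_Beta_real) auto
  moreover have "Beta (real (a+1)) (real (b+1)) = fact a * fact b / fact (a + b + 1)"
    unfolding Beta_def using Gamma_fact[of a, where ?'a=real] Gamma_fact[of b, where ?'a=real]
      Gamma_fact[of "a+b+1", where ?'a=real] by (simp add: algebra_simps)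
  ultimately have 1: "((\<lambda>t::real. t powr (real (a+1) - 1) * (1 - t) powr (real (b+1) - 1))
      has_integral (fact a * fact b / fact (a + b + 1))) {0<..<1}"
    by (simp add: has_integral_Icc_iff_Ioo)
  have "((\<lambda>t::real. t ^ a * (1 - t) ^ b) has_integral (fact a * fact b / fact (a + b + 1))) {0<..<1}"
    by (rule has_integral_eq[OF _ 1]) (auto simp: powr_realpow)
  then have "((\<lambda>t::real. t ^ a * (1 - t) ^ b) has_integral (fact a * fact b / fact (a + b + 1))) {0..1}"
    by (simp add: has_integral_Icc_iff_Ioo)
  then have "((\<lambda>t::real. indicator {0..1} t * (t ^ a * (1 - t) ^ b)) has_integral
      (fact a * fact b / fact (a + b + 1))) UNIV"
    by (subst (asm) has_integral_restrict_UNIV[symmetric])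
       (erule has_integral_eq[rotated], auto simp: indicator_def)
  then have "(\<integral>\<^sup>+v. ennreal (indicator {0..1} v * (v ^ a * (1 - v) ^ b)) \<partial>lborel)
    = ennreal (fact a * fact b / fact (a + b + 1))"
    by (intro nn_integral_has_integral_lborel) (auto simp: indicator_def)
  then show ?thesis
    by (subst (asm) nn_integral_cong[where v="\<lambda>v. ennreal (v ^ a * (1 - v) ^ b) * indicator {0..1} v"])
      (auto simp: indicator_def)
qed

lemma nn_integral_beta_binomial:
  fixes k d :: nat
  assumes "k \<ge> 1"
  shows "(\<integral>\<^sup>+v. ennreal (real k * v ^ (k - 1)) * indicator {0..1} v * ennreal ((1 - v) ^ d) \<partial>lborel)
           = ennreal (1 / real ((k + d) choose k))"
proof -
  have "(\<integral>\<^sup>+v. ennreal (real k * v ^ (k - 1)) * indicator {0..1} v * ennreal ((1 - v) ^ d) \<partial>lborel)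
      = (\<integral>\<^sup>+v. ennreal (real k) * (ennreal (v ^ (k - 1) * (1 - v) ^ d) * indicator {0..1} v) \<partial>lborel)"
    by (intro nn_integral_cong) (auto simp: indicator_def ennreal_mult[symmetric] mult_ac)
  also have "\<dots> = ennreal (real k) * ennreal (fact (k - 1) * fact d / fact (k - 1 + d + 1))"
    by (subst nn_integral_cmult) (auto simp: nn_integral_beta_nat)
  also have "\<dots> = ennreal (real k * (fact (k - 1) * fact d / fact (k + d)))"
    using assms by (subst ennreal_mult[symmetric]) auto
  also have "real k * (fact (k - 1) * fact d / fact (k + d)) = 1 / real ((k + d) choose k)"
    using assms fact_reduce[of k, where ?'a=real] by (simp add: binomial_fact)
  finally show ?thesis .
qed

text \<open>
  The levels are parametrised as \<open>v\<^sup>k\<close> since the functions of interest decay like \<open>(1 - s)\<^sup>k\<close>: the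
  level set at \<open>v\<^sup>k\<close> then compares with a dilate by \<open>1 - v\<close>.
\<close>

lemma nn_integral_layer_cake_power:
  fixes F :: "'b \<Rightarrow> real"
  assumes "sigma_finite_measure M" and [measurable]: "F \<in> borel_measurable M"
    and nonneg: "\<And>x. 0 \<le> F x" and k: "k \<ge> 1"
  shows "(\<integral>\<^sup>+x. ennreal (F x) \<partial>M)
    = (\<integral>\<^sup>+v. ennreal (real k * v ^ (k - 1)) * indicator {0..} v
              * emeasure M {x \<in> space M. v ^ k \<le> F x} \<partial>lborel)"
proof -
  interpret sigma_finite_measure M by fact
  interpret P: pair_sigma_finite M lborel ..
  let ?w = "\<lambda>v::real. ennreal (real k * v ^ (k - 1)) * indicator {0..} v"
  have 1: "ennreal (F x) = (\<integral>\<^sup>+v. ?w v * indicator {v. v ^ k \<le> F x} v \<partial>lborel)" for x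
  proof -
    define r where "r = root k (F x)"
    have r: "r \<ge> 0" "r ^ k = F x" using k nonneg[of x] by (auto simp: r_def)
    have *: "v ^ k \<le> F x \<longleftrightarrow> v \<le> r" if "0 \<le> v" for v
      using r that k by (metis power_mono_iff less_le_trans zero_less_one)
    have "(\<integral>\<^sup>+v. ?w v * indicator {v. v ^ k \<le> F x} v \<partial>lborel)
      = (\<integral>\<^sup>+v. ennreal (real k * v ^ (k - 1)) * indicator {0..r} v \<partial>lborel)"
      by (intro nn_integral_cong) (auto simp: indicator_def *)
    also have "\<dots> = ennreal (r ^ k - 0 ^ k)"
      using r k by (intro nn_integral_FTC_Icc) (auto intro!: derivative_eq_intros)
    also have "\<dots> = ennreal (F x)" using r k by (simp add: power_0_left)
    finally show ?thesis by simp
  qed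
  have "(\<integral>\<^sup>+x. ennreal (F x) \<partial>M) = (\<integral>\<^sup>+x. (\<integral>\<^sup>+v. ?w v * indicator {v. v ^ k \<le> F x} v \<partial>lborel) \<partial>M)"
    using 1 by simp
  also have "\<dots> = (\<integral>\<^sup>+v. (\<integral>\<^sup>+x. ?w v * indicator {v. v ^ k \<le> F x} v \<partial>M) \<partial>lborel)"
    by (rule P.Fubini'[symmetric]) simp
  also have "\<dots> = (\<integral>\<^sup>+v. ?w v * emeasure M {x \<in> space M. v ^ k \<le> F x} \<partial>lborel)"
  proof (intro nn_integral_cong)
    fix v :: real
    have "(\<integral>\<^sup>+x. ?w v * indicator {v. v ^ k \<le> F x} v \<partial>M)
      = (\<integral>\<^sup>+x. ?w v * indicator {x \<in> space M. v ^ k \<le> F x} x \<partial>M)"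
      by (intro nn_integral_cong) (auto simp: indicator_def)
    then show "(\<integral>\<^sup>+x. ?w v * indicator {v. v ^ k \<le> F x} v \<partial>M)
       = ?w v * emeasure M {x \<in> space M. v ^ k \<le> F x}"
      by (simp add: nn_integral_cmult_indicator)
  qed
  finally show ?thesis .
qed

lemma borel_scaleR_image:
  fixes A :: "'b::euclidean_space set"
  assumes "A \<in> sets borel"
  shows "(*\<^sub>R) s ` A \<in> sets borel"
proof (cases "s = 0")
  case True
  then have "(*\<^sub>R) s ` A \<subseteq> {0}" by auto
  then show ?thesis by (metis finite.emptyI finite_insert rev_finite_subset borel_closed finite_imp_closed)
next
  case False
  have "(*\<^sub>R) s ` A = (\<lambda>x. inverse s *\<^sub>R x) -` A \<inter> space borel"
    using False by (force simp: image_iff)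
  also have "\<dots> \<in> sets borel" using assms by (intro measurable_sets[of _ borel borel]) simp_all
  finally show ?thesis .
qed

text \<open>
  The level set of \<open>F\<close> at \<open>v\<^sup>k\<close> contains \<open>(1 - v)C\<close>, whose measure is at least a \<open>(1 - v)\<^sup>d\<close>
  fraction of that of \<open>C\<close>. The set \<open>U\<close> measures a surplus: it lies in the level sets for
  \<open>v\<close> between \<open>v1\<close> and \<open>v2\<close>, outside of the dilates, and makes the bound strict when it has positive
  measure. The inequalities use \<open>U = {}\<close>; the equality cases use a small ball.
\<close>

lemma nn_integral_ge_of_concentric_minorant:
  fixes M :: "'b::euclidean_space measure" and F :: "'b \<Rightarrow> real"
  assumes M: "sigma_finite_measure M" "sets M = sets borel"
    and F: "F \<in> borel_measurable borel" "\<And>x. 0 \<le> F x"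
    and k: "k \<ge> 1" and d: "d \<ge> 1" and C: "C \<in> sets borel" and U: "U \<in> sets borel"
    and scale: "\<And>s. 0 < s \<Longrightarrow> s \<le> 1 \<Longrightarrow> ennreal (s ^ d) * emeasure M C \<le> emeasure M ((*\<^sub>R) s ` C)"
    and low: "\<And>s w. 0 \<le> s \<Longrightarrow> s \<le> 1 \<Longrightarrow> w \<in> C \<Longrightarrow> (1 - s) ^ k \<le> F (s *\<^sub>R w)"
    and v: "0 \<le> v1" "v1 \<le> v2" "v2 < 1"
    and extra: "\<And>v x. v1 \<le> v \<Longrightarrow> v \<le> v2 \<Longrightarrow> x \<in> U \<Longrightarrow> v ^ k \<le> F x \<and> x \<notin> (*\<^sub>R) (1 - v) ` C"
  shows "ennreal (1 / real ((k + d) choose k)) * emeasure M C + ennreal (v2 ^ k - v1 ^ k) * emeasure M U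
           \<le> (\<integral>\<^sup>+x. ennreal (F x) \<partial>M)"
proof -
  interpret sigma_finite_measure M by fact
  have sp[simp]: "space M = UNIV" using sets_eq_imp_space_eq[OF M(2)] by simp
  note [measurable_cong] = M(2)
  have [measurable]: "F \<in> borel_measurable M" "C \<in> sets M" "U \<in> sets M"
    using F C U M(2) measurable_cong_sets[OF M(2) refl] by auto
  let ?w = "\<lambda>v::real. ennreal (real k * v ^ (k - 1))"
  have 1: "?w v * indicator {0..1} v * ennreal ((1 - v) ^ d) * emeasure M C
        + ?w v * indicator {v1..v2} v * emeasure M U
       \<le> ?w v * indicator {0..} v * emeasure M {x. v ^ k \<le> F x}" for v
  proof (cases "0 \<le> v \<and> v < 1")
    case True
    have sub: "(*\<^sub>R) (1 - v) ` C \<subseteq> {x. v ^ k \<le> F x}" using low[of "1 - v"] True by auto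
    have Cv: "(*\<^sub>R) (1 - v) ` C \<in> sets M" using borel_scaleR_image[OF C] M(2) by simp
    have "ennreal ((1 - v) ^ d) * emeasure M C + indicator {v1..v2} v * emeasure M U
        \<le> emeasure M {x. v ^ k \<le> F x}"
    proof (cases "v \<in> {v1..v2}")
      case in12: True
      have "ennreal ((1 - v) ^ d) * emeasure M C + emeasure M U
          \<le> emeasure M ((*\<^sub>R) (1 - v) ` C) + emeasure M U"
        using True by (intro add_right_mono scale) auto
      also have "\<dots> = emeasure M ((*\<^sub>R) (1 - v) ` C \<union> U)"
        using Cv extra[of v] in12 by (intro plus_emeasure) auto
      also have "\<dots> \<le> emeasure M {x. v ^ k \<le> F x}"
        using sub extra[of v] in12 by (intro emeasure_mono) (auto simp: M(2) F)
      finally show ?thesis using in12 by simp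
    next
      case False
      have "ennreal ((1 - v) ^ d) * emeasure M C \<le> emeasure M ((*\<^sub>R) (1 - v) ` C)"
        using True by (intro scale) auto
      also have "\<dots> \<le> emeasure M {x. v ^ k \<le> F x}"
        using sub by (intro emeasure_mono) (auto simp: M(2) F)
      finally show ?thesis using False by simp
    qed
    from mult_left_mono[OF this, of "?w v"] show ?thesis
      using True by (auto simp: distrib_left mult_ac)
  next
    case False
    then have "v \<notin> {v1..v2}" "v = 1 \<or> v \<notin> {0..1}" using v by auto
    then show ?thesis using d by (auto simp: power_0_left)
  qed
  have "ennreal (1 / real ((k + d) choose k)) * emeasure M C + ennreal (v2 ^ k - v1 ^ k) * emeasure M U
     = (\<integral>\<^sup>+v. ?w v * indicator {0..1} v * ennreal ((1 - v) ^ d) * emeasure M C \<partial>lborel)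
        + (\<integral>\<^sup>+v. ?w v * indicator {v1..v2} v * emeasure M U \<partial>lborel)"
  proof -
    have "(\<integral>\<^sup>+v. ?w v * indicator {v1..v2} v \<partial>lborel) = ennreal (v2 ^ k - v1 ^ k)"
      using v k by (intro nn_integral_FTC_Icc) (auto intro!: derivative_eq_intros)
    then show ?thesis
      by (simp add: nn_integral_multc nn_integral_beta_binomial[OF k] del: One_nat_def)
  qed
  also have "\<dots> = (\<integral>\<^sup>+v. ?w v * indicator {0..1} v * ennreal ((1 - v) ^ d) * emeasure M C
        + ?w v * indicator {v1..v2} v * emeasure M U \<partial>lborel)"
    by (intro nn_integral_add[symmetric]) auto
  also have "\<dots> \<le> (\<integral>\<^sup>+v. ?w v * indicator {0..} v * emeasure M {x. v ^ k \<le> F x} \<partial>lborel)"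
    by (intro nn_integral_mono 1)
  also have "\<dots> = (\<integral>\<^sup>+x. ennreal (F x) \<partial>M)"
    using nn_integral_layer_cake_power[OF M(1), of F k] F k by simp
  finally show ?thesis .
qed

lemma emeasure_lborel_scaleR_image:
  fixes A :: "'b::euclidean_space set"
  assumes "A \<in> sets borel" "s \<noteq> 0"
  shows "emeasure lborel ((\<lambda>x. t + s *\<^sub>R x) ` A) = ennreal (\<bar>s\<bar> ^ DIM('b)) * emeasure lborel A"
proof -
  have "(\<lambda>x. t + s *\<^sub>R x) ` A = (\<lambda>x. inverse s *\<^sub>R (x - t)) -` A \<inter> space borel"
    using assms(2) by (force simp: image_iff)
  also have "\<dots> \<in> sets borel" using assms(1) by (intro measurable_sets[of _ borel borel]) simp_all
  finally have 1: "(\<lambda>x. t + s *\<^sub>R x) ` A \<in> sets borel" .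
  have 2: "(\<lambda>x. t + s *\<^sub>R x) -` ((\<lambda>x. t + s *\<^sub>R x) ` A) = A"
    using assms(2) by auto
  have "emeasure lborel ((\<lambda>x. t + s *\<^sub>R x) ` A)
     = emeasure (density (distr lborel borel (\<lambda>x. t + s *\<^sub>R x)) (\<lambda>_. \<bar>s\<bar>^DIM('b))) ((\<lambda>x. t + s *\<^sub>R x) ` A)"
    using lborel_affine[OF assms(2), of t] by simp
  also have "\<dots> = ennreal (\<bar>s\<bar> ^ DIM('b)) * emeasure lborel A"
    using 1 2 by (simp add: emeasure_density_const emeasure_distr)
  finally show ?thesis .
qed

text \<open>
  When the level sets are the dilates themselves, the preceding estimate is attained.
\<close>

lemma nn_integral_eq_of_concentric_levels:
  fixes F :: "'b::euclidean_space \<Rightarrow> real"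
  assumes F: "F \<in> borel_measurable borel" "\<And>x. 0 \<le> F x" "\<And>x. F x \<le> 1"
    and k: "k \<ge> 1" and C: "C \<in> sets borel"
    and level: "\<And>v. 0 < v \<Longrightarrow> v < 1 \<Longrightarrow> {x. v ^ k \<le> F x} = (*\<^sub>R) (1 - v) ` C"
  shows "(\<integral>\<^sup>+x. ennreal (F x) \<partial>lborel)
     = ennreal (1 / real ((k + DIM('b)) choose k)) * emeasure lborel C"
proof -
  let ?w = "\<lambda>v::real. ennreal (real k * v ^ (k - 1))"
  have "(\<integral>\<^sup>+x. ennreal (F x) \<partial>lborel)
     = (\<integral>\<^sup>+v. ?w v * indicator {0..} v * emeasure lborel {x. v ^ k \<le> F x} \<partial>lborel)"
    using nn_integral_layer_cake_power[OF lborel.sigma_finite_measure_axioms, of F k] F k by simp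
  also have "\<dots> = (\<integral>\<^sup>+v. ?w v * indicator {0..1} v * ennreal ((1 - v) ^ DIM('b)) * emeasure lborel C \<partial>lborel)"
  proof (intro nn_integral_cong_AE)
    have "AE v in lborel. v \<noteq> (0::real)" "AE v in lborel. v \<noteq> (1::real)"
      by (rule AE_lborel_singleton)+
    then show "AE v in lborel. ?w v * indicator {0..} v * emeasure lborel {x. v ^ k \<le> F x}
      = ?w v * indicator {0..1} v * ennreal ((1 - v) ^ DIM('b)) * emeasure lborel C"
    proof eventually_elim
      case (elim v)
      consider "v < 0" | "0 < v" "v < 1" | "v > 1" using elim by linarith
      then show ?case
      proof cases
        case 2
        then show ?thesis
          using level[of v] emeasure_lborel_scaleR_image[OF C, of "1 - v" 0] by (simp add: mult_ac)
      next
        case 3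
        then have "\<not> v ^ k \<le> F x" for x
          using F(3)[of x] k one_less_power[of v k] by (meson less_le_trans not_less zero_less_one order_trans)
        then show ?thesis using 3 by simp
      qed auto
    qed
  qed
  also have "\<dots> = ennreal (1 / real ((k + DIM('b)) choose k)) * emeasure lborel C"
    by (simp only: nn_integral_beta_binomial[OF k, symmetric]) (subst nn_integral_multc; simp)
  finally show ?thesis .
qed

section \<open>The overlap function and the Rogers-Shephard body\<close>

text \<open>
  The cone spanned by \<open>K\<close> placed at height one, whose slice at height \<open>t \<ge> 0\<close> is \<open>tK\<close>.
\<close>

definition cone_over :: "'a::euclidean_space set \<Rightarrow> ('a \<times> real) set" where
  "cone_over K = {(x, t). 0 \<le> t \<and> x \<in> (*\<^sub>R) t ` K}"

text \<open>
  The intersection of \<open>(1/2 - t)K\<close> and \<open>x + (1/2 + t)K\<close> at \<open>z = (x, t)\<close>. Membership in the cone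
  makes it empty as soon as \<open>\<bar>t\<bar> > 1/2\<close>. The symmetric parameter \<open>t = \<theta> - 1/2\<close> puts the largest
  overlap at \<open>z = 0\<close>, so that dilations of \<open>\<real>\<^sup>n \<times> \<real>\<close> act linearly.
\<close>

definition overlap :: "'a::euclidean_space set \<Rightarrow> 'a \<times> real \<Rightarrow> 'a set" where
  "overlap K z = {y. (y, 1/2 - snd z) \<in> cone_over K \<and> (y - fst z, 1/2 + snd z) \<in> cone_over K}"

definition rs_body :: "'a::euclidean_space set \<Rightarrow> ('a \<times> real) set" where
  "rs_body K = {z. overlap K z \<noteq> {}}"

lemma cone_over_iff: "(x, t) \<in> cone_over K \<longleftrightarrow> 0 \<le> t \<and> (\<exists>k\<in>K. x = t *\<^sub>R k)"
  by (auto simp: cone_over_def)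

lemma cone_over_eq_conic_hull: "cone_over K = conic hull (K \<times> {1})"
  by (force simp: cone_over_def conic_hull_explicit image_iff)

lemma cone_over_scaleR: "z \<in> cone_over K \<Longrightarrow> 0 \<le> c \<Longrightarrow> c *\<^sub>R z \<in> cone_over K"
  unfolding cone_over_eq_conic_hull using conic_conic_hull conic_def by blast

locale convex_body_with_origin =
  fixes K :: "'a::euclidean_space set"
  assumes compact_K: "compact K" and convex_K: "convex K"
    and interior_K: "interior K \<noteq> {}" and zero_K: "0 \<in> K"
begin

abbreviation "Q \<equiv> cone_over K"

lemma cone_add: "z \<in> Q \<Longrightarrow> z' \<in> Q \<Longrightarrow> z + z' \<in> Q"
proof -
  have "convex Q" unfolding cone_over_eq_conic_hull
    by (intro convex_conic_hull convex_Times convex_K) simp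
  moreover assume "z \<in> Q" "z' \<in> Q"
  ultimately have "(1/2) *\<^sub>R z + (1/2) *\<^sub>R z' \<in> Q" by (intro convexD) auto
  from cone_over_scaleR[OF this, of 2] show ?thesis by (simp add: scaleR_add_right)
qed

lemma cone_comb: "z \<in> Q \<Longrightarrow> z' \<in> Q \<Longrightarrow> 0 \<le> a \<Longrightarrow> 0 \<le> b \<Longrightarrow> a *\<^sub>R z + b *\<^sub>R z' \<in> Q"
  by (intro cone_add cone_over_scaleR)

lemma closed_cone: "closed Q"
  unfolding cone_over_eq_conic_hull
  by (intro closed_conic_hull disjI2) (auto simp: zero_prod_def compact_Times compact_K)

lemma zero_cone: "0 \<in> Q"
  using zero_K by (auto simp: zero_prod_def cone_over_iff)

lemma cone_axis: "0 \<le> t \<Longrightarrow> (0, t) \<in> Q"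
  using zero_K by (auto simp: cone_over_iff)

lemma overlap_convex_comb:
  assumes "y \<in> overlap K z" "y' \<in> overlap K z'" "0 \<le> a" "0 \<le> b" "a + b = 1"
  shows "a *\<^sub>R y + b *\<^sub>R y' \<in> overlap K (a *\<^sub>R z + b *\<^sub>R z')"
proof -
  have b: "b = 1 - a" using assms by simp
  have "a *\<^sub>R (y, 1/2 - snd z) + b *\<^sub>R (y', 1/2 - snd z') \<in> Q"
    "a *\<^sub>R (y - fst z, 1/2 + snd z) + b *\<^sub>R (y' - fst z', 1/2 + snd z') \<in> Q"
    using assms by (intro cone_comb; simp add: overlap_def)+
  moreover have "a *\<^sub>R (y, 1/2 - snd z) + b *\<^sub>R (y', 1/2 - snd z')
      = (a *\<^sub>R y + b *\<^sub>R y', 1/2 - snd (a *\<^sub>R z + b *\<^sub>R z'))"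
    "a *\<^sub>R (y - fst z, 1/2 + snd z) + b *\<^sub>R (y' - fst z', 1/2 + snd z')
      = (a *\<^sub>R y + b *\<^sub>R y' - fst (a *\<^sub>R z + b *\<^sub>R z'), 1/2 + snd (a *\<^sub>R z + b *\<^sub>R z'))"
    by (simp_all add: b algebra_simps) (simp_all add: field_simps)
  ultimately show ?thesis by (simp add: overlap_def)
qed

lemma overlap_0: "overlap K 0 = (*\<^sub>R) (1/2) ` K"
  by (auto simp: overlap_def cone_over_iff)

text \<open>
  The source of the lower estimate: moving from \<open>w\<close> towards the origin, the overlap gains a copy of
  the central overlap \<open>K/2\<close>.
\<close>

lemma overlap_scaleR:
  assumes "y \<in> overlap K w" "0 \<le> s" "s \<le> 1"
  shows "(\<lambda>k. s *\<^sub>R y + ((1 - s) / 2) *\<^sub>R k) ` K \<subseteq> overlap K (s *\<^sub>R w)"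
proof
  fix x assume "x \<in> (\<lambda>k. s *\<^sub>R y + ((1 - s) / 2) *\<^sub>R k) ` K"
  then obtain k where k: "k \<in> K" "x = s *\<^sub>R y + ((1 - s) / 2) *\<^sub>R k" by auto
  have "s *\<^sub>R y + (1 - s) *\<^sub>R ((1/2) *\<^sub>R k) \<in> overlap K (s *\<^sub>R w + (1 - s) *\<^sub>R 0)"
    using assms k by (intro overlap_convex_comb) (auto simp: overlap_0)
  then show "x \<in> overlap K (s *\<^sub>R w)" by (simp add: k)
qed

lemma rs_body_iff:
  "(x, t) \<in> rs_body K \<longleftrightarrow> \<bar>t\<bar> \<le> 1/2 \<and> (\<exists>a\<in>K. \<exists>b\<in>K. x = (1/2 - t) *\<^sub>R a - (1/2 + t) *\<^sub>R b)"
proof -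
  have "(x, t) \<in> rs_body K \<longleftrightarrow>
      (\<exists>y. t \<le> 1/2 \<and> -(1/2) \<le> t \<and> (\<exists>a\<in>K. y = (1/2 - t) *\<^sub>R a) \<and> (\<exists>b\<in>K. y - x = (1/2 + t) *\<^sub>R b))"
    by (auto simp: rs_body_def overlap_def cone_over_iff)
  also have "\<dots> \<longleftrightarrow> t \<le> 1/2 \<and> -(1/2) \<le> t \<and>
      (\<exists>a\<in>K. \<exists>b\<in>K. (1/2 - t) *\<^sub>R a - x = (1/2 + t) *\<^sub>R b)" by blast
  also have "\<dots> \<longleftrightarrow> \<bar>t\<bar> \<le> 1/2 \<and> (\<exists>a\<in>K. \<exists>b\<in>K. x = (1/2 - t) *\<^sub>R a - (1/2 + t) *\<^sub>R b)"
    by (auto simp: algebra_simps abs_le_iff) (metis add_diff_cancel_left' diff_add_cancel diff_diff_eq2)+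
  finally show ?thesis .
qed

lemma convex_rs_body: "convex (rs_body K)"
  unfolding convex_def rs_body_def using overlap_convex_comb by blast

lemma rs_body_axis: "\<bar>t\<bar> \<le> 1/2 \<Longrightarrow> (0, t) \<in> rs_body K"
  unfolding rs_body_iff using zero_K by (auto intro!: bexI[of _ 0])

lemma zero_interior_rs_body: "0 \<in> interior (rs_body K)"
proof -
  obtain c r where r: "r > 0" "ball c r \<subseteq> K" using interior_K by (metis all_not_in_conv mem_interior)
  define e where "e = min (1/4) (r/4)"
  have e: "e > 0" using r by (simp add: e_def)
  have "ball 0 e \<subseteq> rs_body K"
  proof
    fix z :: "'a \<times> real" assume z: "z \<in> ball 0 e"
    obtain x t where xt: "z = (x, t)" by (cases z)
    have "norm x \<le> norm z" "norm t \<le> norm z" using norm_fst_le[of x t] norm_snd_le[of t x] xt by auto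
    then have n: "norm x < r/4" "\<bar>t\<bar> < 1/4" using z by (auto simp: e_def)
    have "c + 4 *\<^sub>R x \<in> K" "c \<in> K" using r n by (auto simp: dist_norm)
    then have 1: "(2 *\<^sub>R x, 0) \<in> rs_body K"
      unfolding rs_body_iff by (intro conjI bexI[of _ "c + 4 *\<^sub>R x"] bexI[of _ c]) (auto simp: algebra_simps)
    have 2: "(0, 2 * t) \<in> rs_body K" using n by (intro rs_body_axis) auto
    have "(1/2) *\<^sub>R (2 *\<^sub>R x, 0) + (1/2) *\<^sub>R (0, 2 * t) \<in> rs_body K"
      by (rule convexD[OF convex_rs_body 1 2]) auto
    then show "z \<in> rs_body K" by (simp add: xt)
  qed
  with e show ?thesis by (auto simp: mem_interior)
qed

text \<open>
  Compactness and measurability of the overlaps, of the body and of its fibres are all read off from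
  this one compact set.
\<close>

lemma compact_overlap_graph: "compact {(z, y). y \<in> overlap K z}"
proof -
  have "closed ((\<lambda>p. (snd p, 1/2 - snd (fst p))) -` Q \<inter> (\<lambda>p. (snd p - fst (fst p), 1/2 + snd (fst p))) -` Q)"
    by (intro closed_Int continuous_closed_vimage closed_cone continuous_intros)
  also have "((\<lambda>p. (snd p, 1/2 - snd (fst p))) -` Q \<inter> (\<lambda>p. (snd p - fst (fst p), 1/2 + snd (fst p))) -` Q)
     = {(z, y). y \<in> overlap K z}" by (auto simp: overlap_def)
  finally have cl: "closed {(z, y). y \<in> overlap K z}" .
  obtain R where R: "\<And>k. k \<in> K \<Longrightarrow> norm k \<le> R" using compact_K compact_imp_bounded bounded_iff by metis
  have "{(z, y). y \<in> overlap K z} \<subseteq> (cball 0 (2 * R) \<times> {-1/2..1/2}) \<times> cball 0 R"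
  proof
    fix p assume "p \<in> {(z, y). y \<in> overlap K z}"
    then obtain x t y where p: "p = ((x, t), y)" "y \<in> overlap K (x, t)" by (cases p) auto
    then obtain a b where *: "\<bar>t\<bar> \<le> 1/2" "a \<in> K" "b \<in> K" "y = (1/2 - t) *\<^sub>R a" "y - x = (1/2 + t) *\<^sub>R b"
      by (auto simp: overlap_def cone_over_iff)
    have "norm y \<le> 1 * R" "norm (y - x) \<le> 1 * R"
      unfolding *(5) norm_scaleR unfolding *(4) norm_scaleR
      using * R by (intro mult_mono; force)+
    moreover have "norm x \<le> norm y + norm (y - x)" using norm_triangle_ineq4[of y "y - x"] by simp
    ultimately show "p \<in> (cball 0 (2 * R) \<times> {-1/2..1/2}) \<times> cball 0 R"
      using *(1) p(1) by auto
  qed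
  then have "bounded {(z, y). y \<in> overlap K z}"
    by (rule bounded_subset[rotated]) (intro bounded_Times bounded_cball compact_imp_bounded[OF compact_Icc])
  with cl show ?thesis by (simp add: compact_eq_bounded_closed)
qed

lemma compact_rs_body: "compact (rs_body K)"
proof -
  have "rs_body K = fst ` {(z, y). y \<in> overlap K z}" by (force simp: rs_body_def)
  then show ?thesis using compact_overlap_graph by (auto intro!: compact_continuous_image continuous_intros)
qed

lemma compact_overlap: "compact (overlap K z)"
proof -
  have "overlap K z = snd ` ({(z, y). y \<in> overlap K z} \<inter> (fst -` {z}))"
    by (auto intro!: image_eqI[where x="(z, _)"])
  moreover have "closed (fst -` {z} :: (('a \<times> real) \<times> 'a) set)"
    by (intro continuous_closed_vimage) (auto intro!: continuous_intros)
  ultimately show ?thesis using compact_overlap_graph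
    by (auto intro!: compact_continuous_image continuous_intros compact_Int_closed)
qed

lemma convex_overlap: "convex (overlap K z)"
  unfolding convex_def using overlap_convex_comb[of _ z _ z] by (auto simp flip: scaleR_left_distrib)

lemma projection_rs_body: "fst ` rs_body K = convex hull (K \<union> uminus ` K)" (is "_ = ?P")
proof
  show "fst ` rs_body K \<subseteq> ?P"
  proof clarsimp
    fix x t assume "(x, t) \<in> rs_body K"
    then obtain a b where *: "\<bar>t\<bar> \<le> 1/2" "a \<in> K" "b \<in> K" "x = (1/2 - t) *\<^sub>R a - (1/2 + t) *\<^sub>R b"
      by (auto simp: rs_body_iff)
    have "a \<in> ?P" "-b \<in> ?P" using * by (auto intro: hull_inc)
    then have "(1/2 - t) *\<^sub>R a + (1/2 + t) *\<^sub>R (-b) \<in> ?P"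
      using * by (intro convexD convex_convex_hull) auto
    then show "x \<in> ?P" using * by simp
  qed
  have 1: "k \<in> fst ` rs_body K" if "k \<in> K" for k
  proof -
    have "(k, -1/2) \<in> rs_body K" using that zero_K by (auto simp: rs_body_iff)
    then show ?thesis by force
  qed
  have 2: "- k \<in> fst ` rs_body K" if "k \<in> K" for k
  proof -
    have "(- k, 1/2) \<in> rs_body K" using that zero_K by (auto simp: rs_body_iff)
    then show ?thesis by force
  qed
  show "?P \<subseteq> fst ` rs_body K"
    using 1 2 by (intro hull_minimal) (auto intro!: convex_linear_image[OF linear_fst] convex_rs_body)
qed

lemma compact_symm_hull: "compact (convex hull (K \<union> uminus ` K))"
  using compact_continuous_image[of "rs_body K" fst] compact_rs_body
  by (simp add: projection_rs_body[symmetric] continuous_intros)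

lemma zero_interior_symm_hull: "0 \<in> interior (convex hull (K \<union> uminus ` K))"
proof -
  obtain e where e: "e > 0" "ball 0 e \<subseteq> rs_body K" using zero_interior_rs_body by (auto simp: mem_interior)
  have "ball 0 e \<subseteq> fst ` rs_body K"
  proof
    fix x :: 'a assume "x \<in> ball 0 e"
    then have "(x, 0) \<in> ball (0 :: 'a \<times> real) e" by (auto simp: norm_Pair)
    then show "x \<in> fst ` rs_body K" using e by (metis fst_conv image_eqI subsetD)
  qed
  then show ?thesis using e by (auto simp: projection_rs_body mem_interior)
qed

end

section \<open>Radial measures and the integral of the overlap volume\<close>

text \<open>
  What a radially decreasing density amounts to for the measure: shrinking a set towards the origin
  by \<open>s\<close> costs at most the factor \<open>s\<^sup>n\<close>. The property passes to products with Lebesgue measure on the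
  line, which is how it reaches the \<open>(n+1)\<close>-dimensional body.
\<close>

definition radial_measure :: "'a::euclidean_space measure \<Rightarrow> bool" where
  "radial_measure \<mu> \<longleftrightarrow> sigma_finite_measure \<mu> \<and> sets \<mu> = sets borel \<and>
     (\<forall>A\<in>sets borel. \<forall>s\<in>{0<..1}. ennreal (s ^ DIM('a)) * emeasure \<mu> A \<le> emeasure \<mu> ((*\<^sub>R) s ` A))"

lemma radial_measureD:
  assumes "radial_measure (\<mu> :: 'a::euclidean_space measure)"
  shows "sigma_finite_measure \<mu>" "sets \<mu> = sets borel"
    "\<And>A s. A \<in> sets borel \<Longrightarrow> 0 < s \<Longrightarrow> s \<le> 1 \<Longrightarrow>
      ennreal (s ^ DIM('a)) * emeasure \<mu> A \<le> emeasure \<mu> ((*\<^sub>R) s ` A)"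
  using assms by (auto simp: radial_measure_def)

lemma radial_measure_lborel: "radial_measure lborel"
  unfolding radial_measure_def
  using emeasure_lborel_scaleR_image[where t=0 and 'b='a]
  by (auto simp: lborel.sigma_finite_measure_axioms)

lemma radial_measure_times_lborel:
  assumes \<mu>: "radial_measure (\<mu> :: 'a::euclidean_space measure)"
  shows "radial_measure (\<mu> \<Otimes>\<^sub>M (lborel :: real measure))"
proof -
  note m = radial_measureD[OF \<mu>]
  note [measurable_cong] = m(2)
  interpret sigma_finite_measure \<mu> by (rule m(1))
  interpret P: pair_sigma_finite \<mu> "lborel :: real measure" ..
  let ?\<nu> = "\<mu> \<Otimes>\<^sub>M (lborel :: real measure)"
  have sets: "sets ?\<nu> = sets (borel :: ('a \<times> real) measure)"
    using sets_pair_measure_cong[OF m(2) sets_lborel[where ?'a=real]] unfolding borel_prod .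
  have "ennreal (s ^ DIM('a \<times> real)) * emeasure ?\<nu> A \<le> emeasure ?\<nu> ((*\<^sub>R) s ` A)"
    if A: "A \<in> sets borel" and s: "0 < s" "s \<le> 1" for A :: "('a \<times> real) set" and s
  proof -
    (* The slice of sA at height st is s times the slice of A at height t; the substitution in the
       height contributes the remaining factor s. *)
    define f where "f = (\<lambda>t. emeasure \<mu> ((\<lambda>x. (x, t)) -` ((*\<^sub>R) s ` A)))"
    have sA: "(*\<^sub>R) s ` A \<in> sets ?\<nu>" "A \<in> sets ?\<nu>" using borel_scaleR_image[OF A] A sets by auto
    have [measurable]: "f \<in> borel_measurable borel"
      using P.measurable_emeasure_Pair2[OF sA(1)] by (simp add: f_def)
    have slice: "(\<lambda>x. (x, s * t)) -` ((*\<^sub>R) s ` A) = (*\<^sub>R) s ` ((\<lambda>x. (x, t)) -` A)" for t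
    proof (intro set_eqI iffI)
      fix x assume "x \<in> (\<lambda>x. (x, s * t)) -` ((*\<^sub>R) s ` A)"
      then show "x \<in> (*\<^sub>R) s ` ((\<lambda>x. (x, t)) -` A)" using s by auto
    qed force
    have slA: "(\<lambda>x. (x, t)) -` A \<in> sets borel" for t
      using sets_Pair2[OF sA(2)] m(2) by auto
    have "ennreal (s ^ DIM('a \<times> real)) * emeasure ?\<nu> A
        = ennreal s * (ennreal (s ^ DIM('a)) * (\<integral>\<^sup>+t. emeasure \<mu> ((\<lambda>x. (x, t)) -` A) \<partial>lborel))"
      using s sA by (simp add: P.emeasure_pair_measure_alt2 ennreal_mult mult.assoc)
    also have "\<dots> = ennreal s * (\<integral>\<^sup>+t. ennreal (s ^ DIM('a)) * emeasure \<mu> ((\<lambda>x. (x, t)) -` A) \<partial>lborel)"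
      using P.measurable_emeasure_Pair2[OF sA(2)] by (subst nn_integral_cmult) auto
    also have "\<dots> \<le> ennreal s * (\<integral>\<^sup>+t. f (s * t) \<partial>lborel)"
      unfolding f_def slice using m(3)[OF slA] s by (intro mult_left_mono nn_integral_mono) auto
    also have "\<dots> = (\<integral>\<^sup>+t. f t \<partial>lborel)"
      using s nn_integral_real_affine[of f s 0] by simp
    also have "\<dots> = emeasure ?\<nu> ((*\<^sub>R) s ` A)"
      unfolding f_def by (rule P.emeasure_pair_measure_alt2[symmetric, OF sA(1)])
    finally show ?thesis .
  qed
  moreover have "sigma_finite_measure ?\<nu>" by (rule P.sigma_finite_measure_axioms)
  ultimately show ?thesis using sets unfolding radial_measure_def by auto
qed

lemma nn_integral_beta_centered:
  "(\<integral>\<^sup>+t. ennreal ((1/2 - t) ^ n * (1/2 + t) ^ n) * indicator {-1/2<..<1/2} t \<partial>lborel)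
     = ennreal (fact n * fact n / fact (2 * n + 1))"
proof -
  have "(\<integral>\<^sup>+t. ennreal ((1/2 - t) ^ n * (1/2 + t) ^ n) * indicator {-1/2<..<1/2} t \<partial>lborel)
    = (\<integral>\<^sup>+t. ennreal ((1 - t) ^ n * t ^ n) * indicator {-1/2<..<1/2} (t - 1/2) \<partial>lborel)"
    by (subst nn_integral_real_affine[where c=1 and t="-1/2"]) (simp_all add: add.commute)
  also have "\<dots> = (\<integral>\<^sup>+t. ennreal (t ^ n * (1 - t) ^ n) * indicator {0..1} t \<partial>lborel)"
  proof (intro nn_integral_cong_AE)
    have "AE v in lborel. v \<noteq> (0::real)" "AE v in lborel. v \<noteq> (1::real)"
      by (rule AE_lborel_singleton)+
    then show "AE t in lborel. ennreal ((1 - t) ^ n * t ^ n) * indicator {-1/2<..<1/2} (t - 1/2)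
      = ennreal (t ^ n * (1 - t) ^ n) * indicator {0..1} t"
      by eventually_elim (auto simp: indicator_def mult.commute)
  qed
  also have "\<dots> = ennreal (fact n * fact n / fact (2 * n + 1))"
    by (simp only: nn_integral_beta_nat mult_2)
  finally show ?thesis .
qed

context convex_body_with_origin
begin

abbreviation "vol_K \<equiv> measure lborel K"

lemma emeasure_compact_real: "compact A \<Longrightarrow> emeasure lborel A = ennreal (measure lborel (A :: 'a set))"
  using emeasure_compact_finite[of A] by (intro emeasure_eq_ennreal_measure) auto

lemma vol_K_pos: "vol_K > 0"
proof -
  obtain c r where r: "r > 0" "ball c r \<subseteq> K" using interior_K by (metis all_not_in_conv mem_interior)
  have "0 < measure lborel (ball c r)" using r content_ball_pos[of r c] by simp
  also have "\<dots> \<le> vol_K"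
    using r compact_K emeasure_compact_finite[OF compact_K]
    by (intro measure_mono_fmeasurable) (auto simp: fmeasurable_def compact_imp_closed)
  finally show ?thesis .
qed

lemma measure_affine_image:
  "0 \<le> s \<Longrightarrow> measure lborel ((\<lambda>x. t + s *\<^sub>R x) ` K) = s ^ DIM('a) * vol_K"
proof (cases "s = 0")
  case True
  then have "(\<lambda>x. t + s *\<^sub>R x) ` K = {t}" using zero_K by auto
  then show ?thesis using True by (simp add: measure_def)
next
  case False
  moreover assume "0 \<le> s"
  ultimately show ?thesis
    using emeasure_lborel_scaleR_image[of K s t] compact_K
    by (simp add: measure_def enn2real_mult compact_imp_closed)
qed

lemma overlap_volume_0: "measure lborel (overlap K 0) = (1/2) ^ DIM('a) * vol_K"
  using measure_affine_image[of "1/2" 0] by (simp add: overlap_0)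

lemma overlap_volume_scaleR:
  assumes "w \<in> rs_body K" "0 \<le> s" "s \<le> 1"
  shows "(1 - s) ^ DIM('a) * measure lborel (overlap K 0) \<le> measure lborel (overlap K (s *\<^sub>R w))"
proof -
  obtain y where y: "y \<in> overlap K w" using assms by (auto simp: rs_body_def)
  have "(1 - s) ^ DIM('a) * measure lborel (overlap K 0) = ((1 - s) / 2) ^ DIM('a) * vol_K"
    by (simp add: overlap_volume_0 power_divide)
  also have "\<dots> = measure lborel ((\<lambda>k. s *\<^sub>R y + ((1 - s) / 2) *\<^sub>R k) ` K)"
    using assms by (subst measure_affine_image) auto
  also have "\<dots> \<le> measure lborel (overlap K (s *\<^sub>R w))"
    using overlap_scaleR[OF y assms(2,3)] compact_overlap[of "s *\<^sub>R w"] emeasure_compact_finite[OF compact_overlap[of "s *\<^sub>R w"]]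
    by (intro measure_mono_fmeasurable)
      (auto simp: fmeasurable_def compact_imp_closed intro!: borel_compact compact_continuous_image compact_K continuous_intros)
  finally show ?thesis .
qed

lemma overlap_graph_borel: "{(z, y). y \<in> overlap K z} \<in> sets (borel \<Otimes>\<^sub>M borel)"
  unfolding borel_prod by (rule borel_compact[OF compact_overlap_graph])

lemma overlap_volume_measurable: "(\<lambda>z. measure lborel (overlap K z)) \<in> borel_measurable borel"
proof -
  have "(\<lambda>z. emeasure lborel (Pair z -` {(z, y). y \<in> overlap K z})) \<in> borel_measurable borel"
    using overlap_graph_borel
    by (intro lborel.measurable_emeasure_Pair) (simp cong: sets_pair_measure_cong)
  then show ?thesis unfolding measure_def by (simp add: vimage_def)
qed

text \<open>
  Fubini in \<open>x\<close> and \<open>y\<close>: the point \<open>y\<close> lies in the overlap at \<open>(x, t)\<close> exactly when it lies in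
  \<open>(1/2 - t)K\<close> and \<open>x\<close> lies in the reflected copy \<open>y - (1/2 + t)K\<close>.
\<close>

lemma overlap_volume_slice:
  assumes \<mu>: "radial_measure \<mu>"
  shows "(\<integral>\<^sup>+x. ennreal (measure lborel (overlap K (x, t))) \<partial>\<mu>)
    = (\<integral>\<^sup>+y. emeasure \<mu> ((\<lambda>k. y - (1/2 + t) *\<^sub>R k) ` K) * indicator ((*\<^sub>R) (1/2 - t) ` K) y \<partial>lborel)
       * indicator {-1/2..1/2} t"
proof -
  note m = radial_measureD[OF \<mu>]
  note [measurable_cong] = m(2)
  interpret sigma_finite_measure \<mu> by (rule m(1))
  interpret P: pair_sigma_finite \<mu> "lborel :: 'a measure" ..
  have [measurable]: "{p. snd p \<in> overlap K (fst p, t)} \<in> sets (\<mu> \<Otimes>\<^sub>M lborel)"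
  proof -
    have "(\<lambda>p. ((fst p, t), snd p)) -` {(z, y). y \<in> overlap K z} \<inter> space (\<mu> \<Otimes>\<^sub>M lborel) \<in> sets (\<mu> \<Otimes>\<^sub>M lborel)"
      by (rule measurable_sets[OF _ overlap_graph_borel]) (simp add: borel_prod[symmetric])
    also have "(\<lambda>p. ((fst p, t), snd p)) -` {(z, y). y \<in> overlap K z} \<inter> space (\<mu> \<Otimes>\<^sub>M lborel) = {p. snd p \<in> overlap K (fst p, t)}"
      using sets_eq_imp_space_eq[OF m(2)] by (auto simp: space_pair_measure)
    finally show ?thesis .
  qed
  have eq: "(\<integral>\<^sup>+x. indicator {p. snd p \<in> overlap K (fst p, t)} (x, y) \<partial>\<mu>)
      = emeasure \<mu> ((\<lambda>k. y - (1/2 + t) *\<^sub>R k) ` K) * indicator ((*\<^sub>R) (1/2 - t) ` K) y * indicator {-1/2..1/2} t" for y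
  proof -
    have "(\<integral>\<^sup>+x. indicator {p. snd p \<in> overlap K (fst p, t)} (x, y) \<partial>\<mu>)
      = (\<integral>\<^sup>+x. indicator ((\<lambda>k. y - (1/2 + t) *\<^sub>R k) ` K) x * (indicator ((*\<^sub>R) (1/2 - t) ` K) y * indicator {-1/2..1/2} t) \<partial>\<mu>)"
    proof (rule nn_integral_cong)
      fix x
      have "y - x \<in> (*\<^sub>R) (1/2 + t) ` K \<longleftrightarrow> x \<in> (\<lambda>k. y - (1/2 + t) *\<^sub>R k) ` K"
        unfolding image_iff by (metis add_diff_cancel_left' diff_add_cancel diff_diff_eq2)
      then show "indicator {p. snd p \<in> overlap K (fst p, t)} (x, y)
         = (indicator ((\<lambda>k. y - (1/2 + t) *\<^sub>R k) ` K) x * (indicator ((*\<^sub>R) (1/2 - t) ` K) y * indicator {-1/2..1/2} t) :: ennreal)"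
        by (auto simp: indicator_def overlap_def cone_over_def)
    qed
    also have "\<dots> = emeasure \<mu> ((\<lambda>k. y - (1/2 + t) *\<^sub>R k) ` K) * (indicator ((*\<^sub>R) (1/2 - t) ` K) y * indicator {-1/2..1/2} t)"
    proof -
      have "compact ((\<lambda>k. y - (1/2 + t) *\<^sub>R k) ` K)"
        by (intro compact_continuous_image compact_K continuous_intros)
      then have "(\<lambda>k. y - (1/2 + t) *\<^sub>R k) ` K \<in> sets \<mu>" using m(2) by (simp add: borel_compact)
      then show ?thesis by (simp add: nn_integral_multc)
    qed
    finally show ?thesis by (simp add: mult.assoc)
  qed
  have "(\<integral>\<^sup>+x. ennreal (measure lborel (overlap K (x, t))) \<partial>\<mu>)
    = (\<integral>\<^sup>+x. (\<integral>\<^sup>+y. indicator {p. snd p \<in> overlap K (fst p, t)} (x, y) \<partial>lborel) \<partial>\<mu>)"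
  proof (rule nn_integral_cong)
    fix x
    have "(\<integral>\<^sup>+y. indicator {p. snd p \<in> overlap K (fst p, t)} (x, y) \<partial>lborel)
      = (\<integral>\<^sup>+y. indicator (overlap K (x, t)) y \<partial>lborel)"
      by (intro nn_integral_cong) (auto simp: indicator_def)
    also have "\<dots> = emeasure lborel (overlap K (x, t))"
      using compact_overlap by (intro nn_integral_indicator) (auto simp: borel_compact)
    finally show "ennreal (measure lborel (overlap K (x, t))) = (\<integral>\<^sup>+y. indicator {p. snd p \<in> overlap K (fst p, t)} (x, y) \<partial>lborel)"
      using emeasure_compact_real[OF compact_overlap] by simp
  qed
  also have "\<dots> = (\<integral>\<^sup>+y. (\<integral>\<^sup>+x. indicator {p. snd p \<in> overlap K (fst p, t)} (x, y) \<partial>\<mu>) \<partial>lborel)"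
    by (rule P.Fubini'[symmetric]) simp
  also have "\<dots> = (\<integral>\<^sup>+y. emeasure \<mu> ((\<lambda>k. y - (1/2 + t) *\<^sub>R k) ` K) * indicator ((*\<^sub>R) (1/2 - t) ` K) y \<partial>lborel)
       * indicator {-1/2..1/2} t"
    unfolding eq by (auto simp: indicator_def)
  finally show ?thesis .
qed

lemma emeasure_scaled_K: "0 \<le> s \<Longrightarrow> emeasure lborel ((*\<^sub>R) s ` K) = ennreal (s ^ DIM('a) * vol_K)"
  using measure_affine_image[of s 0] emeasure_compact_real[of "(*\<^sub>R) s ` K"] compact_scaling[OF compact_K]
  by simp

text \<open>
  The upper estimate. For \<open>\<theta> = 1/2 + t\<close>, points \<open>y\<close> of \<open>(1 - \<theta>)K\<close> have the form required by the
  bound \<open>S\<close>, so the slice contributes at most \<open>S \<theta>\<^sup>n (1 - \<theta>)\<^sup>n vol K\<close>. The endpoints \<open>\<theta> = 0, 1\<close>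
  form a null set.
\<close>

lemma overlap_volume_integral_le:
  assumes \<mu>: "radial_measure \<mu>"
    and S: "\<And>y \<theta>. y \<in> K \<Longrightarrow> 0 < \<theta> \<Longrightarrow> \<theta> \<le> 1 \<Longrightarrow>
      emeasure \<mu> ((\<lambda>x. (1 - \<theta>) *\<^sub>R y - \<theta> *\<^sub>R x) ` K) \<le> S * ennreal (\<theta> ^ DIM('a))"
  shows "(\<integral>\<^sup>+z. ennreal (measure lborel (overlap K z)) \<partial>(\<mu> \<Otimes>\<^sub>M lborel))
    \<le> ennreal (vol_K * (fact DIM('a) * fact DIM('a) / fact (2 * DIM('a) + 1))) * S"
proof -
  note m = radial_measureD[OF \<mu>]
  note [measurable_cong] = m(2)
  interpret sigma_finite_measure \<mu> by (rule m(1))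
  interpret P: pair_sigma_finite \<mu> "lborel :: real measure" ..
  have [measurable]: "(\<lambda>z. measure lborel (overlap K z)) \<in> borel_measurable (\<mu> \<Otimes>\<^sub>M lborel)"
    using overlap_volume_measurable radial_measureD(2)[OF radial_measure_times_lborel[OF \<mu>]]
    using measurable_cong_sets by blast
  have "(\<integral>\<^sup>+z. ennreal (measure lborel (overlap K z)) \<partial>(\<mu> \<Otimes>\<^sub>M lborel))
     = (\<integral>\<^sup>+t. (\<integral>\<^sup>+x. ennreal (measure lborel (overlap K (x, t))) \<partial>\<mu>) \<partial>lborel)"
    by (rule P.nn_integral_snd[symmetric]) simp
  also have "\<dots> \<le> (\<integral>\<^sup>+t. (ennreal ((1/2 - t) ^ DIM('a) * (1/2 + t) ^ DIM('a)) * indicator {-1/2<..<1/2} t)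
       * (ennreal vol_K * S) \<partial>lborel)"
  proof (intro nn_integral_mono_AE)
    have "AE v in lborel. v \<noteq> (1/2::real)" "AE v in lborel. v \<noteq> (-1/2::real)"
      by (rule AE_lborel_singleton)+
    then show "AE t in lborel. (\<integral>\<^sup>+x. ennreal (measure lborel (overlap K (x, t))) \<partial>\<mu>)
       \<le> (ennreal ((1/2 - t) ^ DIM('a) * (1/2 + t) ^ DIM('a)) * indicator {-1/2<..<1/2} t) * (ennreal vol_K * S)"
    proof eventually_elim
      case (elim t)
      show ?case
      proof (cases "t \<in> {-1/2<..<1/2}")
        case True
        have "emeasure \<mu> ((\<lambda>k. y - (1/2 + t) *\<^sub>R k) ` K) * indicator ((*\<^sub>R) (1/2 - t) ` K) y
            \<le> (S * ennreal ((1/2 + t) ^ DIM('a))) * indicator ((*\<^sub>R) (1/2 - t) ` K) y" for y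
          using S[where \<theta>="1/2 + t"] True by (auto simp: indicator_def)
        then have "(\<integral>\<^sup>+x. ennreal (measure lborel (overlap K (x, t))) \<partial>\<mu>)
           \<le> (\<integral>\<^sup>+y. (S * ennreal ((1/2 + t) ^ DIM('a))) * indicator ((*\<^sub>R) (1/2 - t) ` K) y \<partial>lborel)"
          unfolding overlap_volume_slice[OF \<mu>] using True by (auto intro!: nn_integral_mono)
        also have "\<dots> = S * ennreal ((1/2 + t) ^ DIM('a)) * ennreal ((1/2 - t) ^ DIM('a) * vol_K)"
          using True compact_scaling[OF compact_K]
          by (subst nn_integral_cmult_indicator) (auto simp: emeasure_scaled_K borel_compact)
        also have "\<dots> = (ennreal ((1/2 - t) ^ DIM('a) * (1/2 + t) ^ DIM('a)) * indicator {-1/2<..<1/2} t) * (ennreal vol_K * S)"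
          using True by (simp add: ennreal_mult mult_ac)
        finally show ?thesis .
      next
        case False
        then show ?thesis using elim unfolding overlap_volume_slice[OF \<mu>] by auto
      qed
    qed
  qed
  also have "\<dots> = ennreal (fact DIM('a) * fact DIM('a) / fact (2 * DIM('a) + 1)) * (ennreal vol_K * S)"
    unfolding nn_integral_beta_centered[symmetric] by (rule nn_integral_multc) simp
  also have "\<dots> = ennreal (vol_K * (fact DIM('a) * fact DIM('a) / fact (2 * DIM('a) + 1))) * S"
    by (subst ennreal_mult) (auto simp: mult_ac)
  finally show ?thesis .
qed

lemma reflected_copy_volume:
  assumes "0 < \<theta>"
  shows "emeasure lborel ((\<lambda>x. y - \<theta> *\<^sub>R x) ` K) = ennreal vol_K * ennreal (\<theta> ^ DIM('a))"
  using emeasure_lborel_scaleR_image[of K "-\<theta>" y] assms compact_K emeasure_compact_real[OF compact_K]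
  by (simp add: borel_compact mult.commute)

text \<open>
  For Lebesgue measure all reflected copies have the same normalised volume, and the upper estimate
  is an identity.
\<close>

lemma overlap_volume_integral_lborel:
  "(\<integral>\<^sup>+z. ennreal (measure lborel (overlap K z)) \<partial>lborel)
    = ennreal (vol_K * (fact DIM('a) * fact DIM('a) / fact (2 * DIM('a) + 1)) * vol_K)"
proof -
  have [measurable]: "(\<lambda>z. measure lborel (overlap K z)) \<in> borel_measurable (lborel \<Otimes>\<^sub>M lborel)"
    using overlap_volume_measurable by (simp add: lborel_prod)
  have "(\<integral>\<^sup>+z. ennreal (measure lborel (overlap K z)) \<partial>lborel)
     = (\<integral>\<^sup>+t. (\<integral>\<^sup>+x. ennreal (measure lborel (overlap K (x, t))) \<partial>lborel) \<partial>lborel)"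
    unfolding lborel_prod[symmetric] by (rule lborel_pair.nn_integral_snd[symmetric]) simp
  also have "\<dots> = (\<integral>\<^sup>+t. (ennreal ((1/2 - t) ^ DIM('a) * (1/2 + t) ^ DIM('a)) * indicator {-1/2<..<1/2} t)
       * (ennreal vol_K * ennreal vol_K) \<partial>lborel)"
  proof (intro nn_integral_cong_AE)
    have "AE v in lborel. v \<noteq> (1/2::real)" "AE v in lborel. v \<noteq> (-1/2::real)"
      by (rule AE_lborel_singleton)+
    then show "AE t in lborel. (\<integral>\<^sup>+x. ennreal (measure lborel (overlap K (x, t))) \<partial>lborel)
       = (ennreal ((1/2 - t) ^ DIM('a) * (1/2 + t) ^ DIM('a)) * indicator {-1/2<..<1/2} t) * (ennreal vol_K * ennreal vol_K)"
    proof eventually_elim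
      case (elim t)
      show ?case
      proof (cases "t \<in> {-1/2<..<1/2}")
        case True
        then have "(\<integral>\<^sup>+x. ennreal (measure lborel (overlap K (x, t))) \<partial>lborel)
           = (\<integral>\<^sup>+y. (ennreal vol_K * ennreal ((1/2 + t) ^ DIM('a))) * indicator ((*\<^sub>R) (1/2 - t) ` K) y \<partial>lborel)"
          unfolding overlap_volume_slice[OF radial_measure_lborel]
          by (auto simp: reflected_copy_volume)
        also have "\<dots> = ennreal vol_K * ennreal ((1/2 + t) ^ DIM('a)) * ennreal ((1/2 - t) ^ DIM('a) * vol_K)"
          using True compact_scaling[OF compact_K]
          by (subst nn_integral_cmult_indicator) (auto simp: emeasure_scaled_K borel_compact)
        also have "\<dots> = (ennreal ((1/2 - t) ^ DIM('a) * (1/2 + t) ^ DIM('a)) * indicator {-1/2<..<1/2} t) * (ennreal vol_K * ennreal vol_K)"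
          using True by (simp add: ennreal_mult mult_ac)
        finally show ?thesis .
      next
        case False
        then show ?thesis using elim unfolding overlap_volume_slice[OF radial_measure_lborel] by auto
      qed
    qed
  qed
  also have "\<dots> = ennreal (fact DIM('a) * fact DIM('a) / fact (2 * DIM('a) + 1)) * (ennreal vol_K * ennreal vol_K)"
    unfolding nn_integral_beta_centered[symmetric] by (rule nn_integral_multc) simp
  also have "\<dots> = ennreal (vol_K * (fact DIM('a) * fact DIM('a) / fact (2 * DIM('a) + 1)) * vol_K)"
    by (simp add: ennreal_mult[symmetric] mult_ac del: fact_Suc)
  finally show ?thesis .
qed

end

section \<open>The two inequalities for radial measures\<close>

text \<open>
  The quotient of the Beta integral of the upper estimate by that of the lower one is \<open>1/(n+1)\<close>.
\<close>

lemma central_beta_eq: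
  "fact n * fact n / fact (2 * n + 1) = (1 / real ((n + Suc n) choose n)) / (real n + 1)"
proof -
  have "real ((n + Suc n) choose n) = fact (2 * n + 1) / (fact n * fact (Suc n))"
    using binomial_fact[of n "n + Suc n", where ?'a=real] by (simp add: mult_2 del: fact_Suc)
  also have "fact (Suc n) = (real n + 1) * fact n" by simp
  finally show ?thesis by (simp del: fact_Suc)
qed

context convex_body_with_origin
begin

text \<open>
  The two estimates of the integral of the overlap volume put together. The surplus set \<open>U\<close> is kept
  because equality will be refuted by exhibiting a ball in it.
\<close>

lemma rs_body_measure_gap:
  assumes \<mu>: "radial_measure \<mu>"
    and S: "\<And>y \<theta>. y \<in> K \<Longrightarrow> 0 < \<theta> \<Longrightarrow> \<theta> \<le> 1 \<Longrightarrow>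
      emeasure \<mu> ((\<lambda>x. (1 - \<theta>) *\<^sub>R y - \<theta> *\<^sub>R x) ` K) \<le> S * ennreal (\<theta> ^ DIM('a))"
    and U: "U \<in> sets borel" and v: "0 \<le> v1" "v1 \<le> v2" "v2 < 1"
    and extra: "\<And>v z. v1 \<le> v \<Longrightarrow> v \<le> v2 \<Longrightarrow> z \<in> U \<Longrightarrow>
      v ^ DIM('a) * measure lborel (overlap K 0) \<le> measure lborel (overlap K z) \<and> z \<notin> (*\<^sub>R) (1 - v) ` rs_body K"
  shows "ennreal (1 / real ((DIM('a) + Suc DIM('a)) choose DIM('a))) * emeasure (\<mu> \<Otimes>\<^sub>M lborel) (rs_body K)
          + ennreal (v2 ^ DIM('a) - v1 ^ DIM('a)) * emeasure (\<mu> \<Otimes>\<^sub>M lborel) U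
    \<le> ennreal (1 / real ((DIM('a) + Suc DIM('a)) choose DIM('a)) * (2 ^ DIM('a) / (real DIM('a) + 1))) * S"
proof -
  let ?F = "\<lambda>z. measure lborel (overlap K z)" and ?\<nu> = "\<mu> \<Otimes>\<^sub>M (lborel :: real measure)"
  have F0: "?F 0 > 0" using vol_K_pos by (simp add: overlap_volume_0)
  note \<nu> = radial_measureD[OF radial_measure_times_lborel[OF \<mu>]]
  have Fm: "?F \<in> borel_measurable ?\<nu>"
    using overlap_volume_measurable measurable_cong_sets[OF \<nu>(2) refl] by blast
  have "ennreal (1 / real ((DIM('a) + Suc DIM('a)) choose DIM('a))) * emeasure ?\<nu> (rs_body K)
          + ennreal (v2 ^ DIM('a) - v1 ^ DIM('a)) * emeasure ?\<nu> U
      \<le> (\<integral>\<^sup>+z. ennreal (?F z / ?F 0) \<partial>?\<nu>)"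
  proof (rule nn_integral_ge_of_concentric_minorant)
    show "ennreal (s ^ Suc DIM('a)) * emeasure ?\<nu> (rs_body K) \<le> emeasure ?\<nu> ((*\<^sub>R) s ` rs_body K)"
      if "0 < s" "s \<le> 1" for s
      using \<nu>(3)[of "rs_body K" s] that compact_rs_body by (simp add: borel_compact)
    show "(1 - s) ^ DIM('a) \<le> ?F (s *\<^sub>R w) / ?F 0" if "0 \<le> s" "s \<le> 1" "w \<in> rs_body K" for s w
      using overlap_volume_scaleR[OF that(3,1,2)] F0 by (simp add: field_simps)
    show "v ^ DIM('a) \<le> ?F z / ?F 0 \<and> z \<notin> (*\<^sub>R) (1 - v) ` rs_body K"
      if "v1 \<le> v" "v \<le> v2" "z \<in> U" for v z
      using extra[OF that] F0 by (simp add: field_simps)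
  qed (use U v \<nu> overlap_volume_measurable compact_rs_body F0 in \<open>auto simp: borel_compact DIM_positive Suc_le_eq\<close>)
  also have "\<dots> = (\<integral>\<^sup>+z. ennreal (?F z) \<partial>?\<nu>) * ennreal (1 / ?F 0)"
    using Fm F0 by (subst nn_integral_multc[symmetric]) (auto simp: ennreal_mult[symmetric])
  also have "\<dots> \<le> ennreal (vol_K * (fact DIM('a) * fact DIM('a) / fact (2 * DIM('a) + 1))) * S * ennreal (1 / ?F 0)"
    by (intro mult_right_mono overlap_volume_integral_le[OF \<mu> S]) auto
  also have "\<dots> = ennreal (vol_K * (fact DIM('a) * fact DIM('a) / fact (2 * DIM('a) + 1)) * (1 / ?F 0)) * S"
    using F0 by (subst (2) ennreal_mult) (auto simp: mult_ac)
  also have "vol_K * (fact DIM('a) * fact DIM('a) / fact (2 * DIM('a) + 1)) * (1 / ?F 0)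
      = 1 / real ((DIM('a) + Suc DIM('a)) choose DIM('a)) * (2 ^ DIM('a) / (real DIM('a) + 1))"
    unfolding central_beta_eq overlap_volume_0 using vol_K_pos by (simp add: field_simps power_divide)
  finally show ?thesis .
qed

lemma rs_body_measure_le:
  assumes \<mu>: "radial_measure \<mu>"
    and S: "\<And>y \<theta>. y \<in> K \<Longrightarrow> 0 < \<theta> \<Longrightarrow> \<theta> \<le> 1 \<Longrightarrow>
      emeasure \<mu> ((\<lambda>x. (1 - \<theta>) *\<^sub>R y - \<theta> *\<^sub>R x) ` K) \<le> S * ennreal (\<theta> ^ DIM('a))"
  shows "emeasure (\<mu> \<Otimes>\<^sub>M lborel) (rs_body K) \<le> ennreal (2 ^ DIM('a) / (real DIM('a) + 1)) * S"
proof -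
  define c where "c = real ((DIM('a) + Suc DIM('a)) choose DIM('a))"
  have c: "c > 0" by (simp add: c_def)
  have "ennreal (1 / c) * emeasure (\<mu> \<Otimes>\<^sub>M lborel) (rs_body K)
      \<le> ennreal (1 / c * (2 ^ DIM('a) / (real DIM('a) + 1))) * S"
    using rs_body_measure_gap[OF \<mu> S, of "{}" 0 0] unfolding c_def by simp
  from mult_left_mono[OF this, of "ennreal c"] show ?thesis
    using c by (simp add: mult.assoc[symmetric] ennreal_mult[symmetric])
qed

lemma rs_fibre_compact: "compact (Pair x -` rs_body K)"
proof -
  have "Pair x -` rs_body K = snd ` (rs_body K \<inter> fst -` {x})"
    by (auto intro!: image_eqI[where x="(x, _)"])
  moreover have "closed (fst -` {x} :: ('a \<times> real) set)"
    by (intro continuous_closed_vimage) (auto intro!: continuous_intros)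
  ultimately show ?thesis using compact_rs_body
    by (auto intro!: compact_continuous_image continuous_intros compact_Int_closed)
qed

text \<open>
  The fibre over \<open>sx\<close> contains an \<open>s\<close>-multiple of a point of the fibre over \<open>x\<close> plus a
  \<open>(1 - s)\<close>-multiple of the full interval over the origin.
\<close>

lemma rs_fibre_scaleR:
  assumes "(x, t) \<in> rs_body K" "0 \<le> s" "s \<le> 1"
  shows "{s * t - (1 - s) / 2 .. s * t + (1 - s) / 2} \<subseteq> Pair (s *\<^sub>R x) -` rs_body K"
proof
  fix u assume u: "u \<in> {s * t - (1 - s) / 2 .. s * t + (1 - s) / 2}"
  show "u \<in> Pair (s *\<^sub>R x) -` rs_body K"
  proof (cases "s = 1")
    case True
    then show ?thesis using u assms by auto
  next
    case False
    then have s: "s < 1" using assms by simp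
    define w where "w = (u - s * t) / (1 - s)"
    have "\<bar>u - s * t\<bar> \<le> (1 - s) / 2" using u by (intro abs_leI) (auto simp: field_simps)
    then have w: "\<bar>w\<bar> \<le> 1/2" and uw: "u = s * t + (1 - s) * w"
      using s by (auto simp: w_def abs_divide divide_le_eq)
    have "s *\<^sub>R (x, t) + (1 - s) *\<^sub>R (0, w) \<in> rs_body K"
      using assms w by (intro convexD[OF convex_rs_body] rs_body_axis) auto
    then show ?thesis by (simp add: uw)
  qed
qed

lemma rs_fibre_length_ge:
  assumes "{a..b} \<subseteq> Pair x -` rs_body K"
  shows "b - a \<le> measure lborel (Pair x -` rs_body K)"
proof -
  have "measure lborel {a..b} \<le> measure lborel (Pair x -` rs_body K)"
    using assms emeasure_compact_finite[OF rs_fibre_compact[of x]]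
    by (intro measure_mono_fmeasurable) (auto simp: fmeasurable_def borel_compact rs_fibre_compact)
  then show ?thesis by (cases "a \<le> b") (auto intro: order_trans[OF _ measure_nonneg])
qed

lemma emeasure_rs_fibre:
  "emeasure lborel (Pair x -` rs_body K) = ennreal (measure lborel (Pair x -` rs_body K))"
  using emeasure_compact_finite[OF rs_fibre_compact, of x] by (intro emeasure_eq_ennreal_measure) auto

lemma rs_fibre_measurable: "(\<lambda>x. measure lborel (Pair x -` rs_body K)) \<in> borel_measurable borel"
proof -
  have "rs_body K \<in> sets (borel \<Otimes>\<^sub>M borel)" unfolding borel_prod by (rule borel_compact[OF compact_rs_body])
  then have "(\<lambda>z. emeasure lborel (Pair z -` rs_body K)) \<in> borel_measurable borel"
    by (intro lborel.measurable_emeasure_Pair) (simp cong: sets_pair_measure_cong)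
  then show ?thesis unfolding measure_def by simp
qed

lemma rs_body_measure_eq_fibres:
  assumes \<mu>: "radial_measure \<mu>"
  shows "emeasure (\<mu> \<Otimes>\<^sub>M lborel) (rs_body K) = (\<integral>\<^sup>+x. ennreal (measure lborel (Pair x -` rs_body K)) \<partial>\<mu>)"
proof -
  have "rs_body K \<in> sets (\<mu> \<Otimes>\<^sub>M lborel)"
    using radial_measureD(2)[OF radial_measure_times_lborel[OF \<mu>]] compact_rs_body by (simp add: borel_compact)
  then show ?thesis by (simp add: lborel.emeasure_pair_measure_alt emeasure_rs_fibre)
qed

abbreviation "symm_hull \<equiv> convex hull (K \<union> uminus ` K)"

text \<open>
  The layer-cake bound for the fibre length, with exponent \<open>1\<close> in dimension \<open>n\<close>.
\<close>

lemma symm_hull_measure_gap: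
  assumes \<mu>: "radial_measure \<mu>"
    and U: "U \<in> sets borel" and v: "0 \<le> v1" "v1 \<le> v2" "v2 < 1"
    and extra: "\<And>v x. v1 \<le> v \<Longrightarrow> v \<le> v2 \<Longrightarrow> x \<in> U \<Longrightarrow>
      v \<le> measure lborel (Pair x -` rs_body K) \<and> x \<notin> (*\<^sub>R) (1 - v) ` symm_hull"
  shows "ennreal (1 / (real DIM('a) + 1)) * emeasure \<mu> symm_hull + ennreal (v2 - v1) * emeasure \<mu> U
    \<le> emeasure (\<mu> \<Otimes>\<^sub>M lborel) (rs_body K)"
proof -
  let ?F = "\<lambda>x. measure lborel (Pair x -` rs_body K)"
  note m = radial_measureD[OF \<mu>]
  have "ennreal (1 / real ((1 + DIM('a)) choose 1)) * emeasure \<mu> symm_hull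
      + ennreal (v2 ^ 1 - v1 ^ 1) * emeasure \<mu> U \<le> (\<integral>\<^sup>+x. ennreal (?F x) \<partial>\<mu>)"
  proof (rule nn_integral_ge_of_concentric_minorant)
    show "ennreal (s ^ DIM('a)) * emeasure \<mu> symm_hull \<le> emeasure \<mu> ((*\<^sub>R) s ` symm_hull)"
      if "0 < s" "s \<le> 1" for s
      using m(3)[of symm_hull s] that compact_symm_hull by (simp add: borel_compact)
    show "(1 - s) ^ 1 \<le> ?F (s *\<^sub>R w)" if "0 \<le> s" "s \<le> 1" "w \<in> symm_hull" for s w
    proof -
      obtain t where "(w, t) \<in> rs_body K" using \<open>w \<in> symm_hull\<close> by (auto simp: projection_rs_body[symmetric])
      from rs_fibre_length_ge[OF rs_fibre_scaleR[OF this that(1,2)]] show ?thesis by (simp add: field_simps)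
    qed
    show "v ^ 1 \<le> ?F x \<and> x \<notin> (*\<^sub>R) (1 - v) ` symm_hull" if "v1 \<le> v" "v \<le> v2" "x \<in> U" for v x
      using extra[OF that] by simp
  qed (use U v m rs_fibre_measurable compact_symm_hull in \<open>auto simp: borel_compact DIM_positive Suc_le_eq\<close>)
  then show ?thesis by (simp add: rs_body_measure_eq_fibres[OF \<mu>] add.commute)
qed

lemma symm_hull_measure_le:
  assumes \<mu>: "radial_measure \<mu>"
  shows "emeasure \<mu> symm_hull \<le> ennreal (real DIM('a) + 1) * emeasure (\<mu> \<Otimes>\<^sub>M lborel) (rs_body K)"
proof -
  have "ennreal (1 / (real DIM('a) + 1)) * emeasure \<mu> symm_hull \<le> emeasure (\<mu> \<Otimes>\<^sub>M lborel) (rs_body K)"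
    using symm_hull_measure_gap[OF \<mu>, of "{}" 0 0] by simp
  from mult_left_mono[OF this, of "ennreal (real DIM('a) + 1)"] show ?thesis
    by (simp add: mult.assoc[symmetric] ennreal_mult[symmetric] del: ennreal_plus)
qed

end

section \<open>Equality forces a simplex\<close>

lemma compact_convex_eq_of_measure_eq:
  fixes A B :: "'a::euclidean_space set"
  assumes A: "compact A" "convex A" "interior A \<noteq> {}" and B: "compact B" "B \<subseteq> A"
    and eq: "measure lborel A \<le> measure lborel B"
  shows "A = B"
proof (rule ccontr)
  assume "A \<noteq> B"
  then obtain a where a: "a \<in> A" "a \<notin> B" using B by auto
  have "a \<in> closure (interior A)"
    using a A convex_closure_interior compact_imp_closed by (metis closure_closed)
  moreover have "open (- B)" using B compact_imp_closed by auto
  ultimately have "interior A \<inter> - B \<noteq> {}"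
    using a open_Int_closure_eq_empty[of "- B" "interior A"] by auto
  then obtain c r where r: "r > 0" "ball c r \<subseteq> interior A \<inter> - B"
    using \<open>open (- B)\<close> by (metis open_Int open_interior open_contains_ball ex_in_conv)
  have fin: "A \<in> fmeasurable lborel" "B \<in> fmeasurable lborel" "ball c r \<in> fmeasurable lborel"
    using A B emeasure_compact_finite[of A] emeasure_compact_finite[of B] emeasure_lborel_ball_finite[of c r]
    by (auto simp: fmeasurable_def borel_compact)
  have "measure lborel B + measure lborel (ball c r) = measure lborel (B \<union> ball c r)"
    using fin r by (intro measure_Union[symmetric]) (auto simp: fmeasurable_def)
  also have "\<dots> \<le> measure lborel A"
    using fin r B interior_subset[of A] by (intro measure_mono_fmeasurable) (auto simp: fmeasurable_def)
  finally have "measure lborel (ball c r) \<le> 0" using eq by linarith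
  then show False using r content_ball_pos[of r c] by linarith
qed

context convex_body_with_origin
begin

lemma sum_in_cone: "(\<And>v. v \<in> L \<Longrightarrow> f v \<in> Q) \<Longrightarrow> (\<Sum>v\<in>L. f v) \<in> Q"
  by (induction L rule: infinite_finite_induct) (auto simp: zero_cone cone_add)

text \<open>
  Lower semicontinuity of the overlap volume in the interior of the body: every point close to \<open>z\<close> is
  such a combination with small \<open>e\<close>.
\<close>

lemma overlap_volume_nearby:
  assumes "z \<in> rs_body K" "z' \<in> rs_body K" "0 \<le> e" "e \<le> 1"
  shows "(1 - e) ^ DIM('a) * measure lborel (overlap K z) \<le> measure lborel (overlap K ((1 - e) *\<^sub>R z + e *\<^sub>R z'))"
proof (cases "e = 1")
  case True
  then show ?thesis by (simp add: power_0_left)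
next
  case False
  obtain y where y: "y \<in> overlap K z'" using assms by (auto simp: rs_body_def)
  let ?z = "(1 - e) *\<^sub>R z + e *\<^sub>R z'" and ?A = "(\<lambda>x. e *\<^sub>R y + (1 - e) *\<^sub>R x) ` overlap K z"
  have "(1 - e) ^ DIM('a) * measure lborel (overlap K z) = measure lborel ?A"
    using emeasure_lborel_scaleR_image[of "overlap K z" "1 - e" "e *\<^sub>R y"] False assms
      borel_compact[OF compact_overlap[of z]]
    by (simp add: measure_def enn2real_mult)
  also have "\<dots> \<le> measure lborel (overlap K ?z)"
  proof (rule measure_mono_fmeasurable)
    show "?A \<subseteq> overlap K ?z"
      using overlap_convex_comb[OF _ y, of _ z "1 - e" e] assms by (auto simp: add.commute)
    show "?A \<in> sets lborel"
      by (simp, intro borel_compact compact_continuous_image compact_overlap continuous_intros)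
    show "overlap K ?z \<in> fmeasurable lborel"
      using emeasure_compact_finite[OF compact_overlap[of ?z]] by (auto simp: fmeasurable_def borel_compact compact_overlap)
  qed
  finally show ?thesis .
qed

text \<open>
  Under equality the lower estimate must be sharp everywhere, not just almost everywhere. If the
  overlap at \<open>sw\<close> were too large, it would still be too large on a ball around \<open>sw\<close>; since \<open>w\<close> is the
  last point of \<open>C\<close> on its ray, this ball can be chosen outside of the smaller dilates of \<open>C\<close>, and
  it would be a surplus of positive measure.
\<close>

lemma overlap_volume_of_equality:
  assumes eq: "ennreal (2 ^ DIM('a) / (real DIM('a) + 1)) * ennreal vol_K \<le> emeasure lborel (rs_body K)"
    and w: "w \<in> rs_body K" "\<And>c. 1 < c \<Longrightarrow> c *\<^sub>R w \<notin> rs_body K" and s: "0 < s" "s < 1"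
  shows "measure lborel (overlap K (s *\<^sub>R w)) \<le> (1 - s) ^ DIM('a) * measure lborel (overlap K 0)"
proof (rule ccontr)
  define n where "n = DIM('a)"
  have n: "n \<ge> 1" "n > 0" unfolding n_def by (simp_all add: DIM_positive Suc_le_eq)
  let ?F = "\<lambda>z. measure lborel (overlap K z)"
  define g where "g = ?F (s *\<^sub>R w) / ?F 0"
  have F0: "?F 0 > 0" using vol_K_pos by (simp add: overlap_volume_0)
  assume "\<not> ?thesis"
  then have g: "(1 - s) ^ n < g" using F0 by (simp add: g_def n_def field_simps)
  then have g0: "g > 0" using s by (meson diff_gt_0_iff_gt less_trans zero_less_power)
  have "1 - s < root n g" using g s n real_root_less_mono[OF n(2) g] by (simp add: real_root_power_cancel)
  then have "1 - s < min 1 (root n g)" using s by simp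
  then obtain v2 where v2: "1 - s < v2" "v2 < min 1 (root n g)" using dense by blast
  then obtain v1 where v1: "1 - s < v1" "v1 < v2" using dense by blast
  (* e is chosen so that shrinking by (1 - e) brings the relative volume g at sw down to v2^n. *)
  define e where "e = 1 - v2 / root n g"
  have e: "0 < e" "e < 1" using v2 s by (auto simp: e_def field_simps)
  have Fs: "?F (s *\<^sub>R w) > 0" using g0 F0 by (simp add: g_def zero_less_divide_iff)
  have eF: "(1 - e) ^ n * ?F (s *\<^sub>R w) = v2 ^ n * ?F 0"
    using F0 g0 n Fs by (simp add: e_def power_divide) (simp add: g_def)
  obtain r where r: "r > 0" "ball 0 r \<subseteq> rs_body K" using zero_interior_rs_body by (auto simp: mem_interior)
  have sub: "(*\<^sub>R) (1 - v) ` rs_body K \<subseteq> (*\<^sub>R) (1 - v1) ` rs_body K" if "v1 \<le> v" "v < 1" for v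
  proof
    fix x assume "x \<in> (*\<^sub>R) (1 - v) ` rs_body K"
    then obtain c where c: "c \<in> rs_body K" "x = (1 - v) *\<^sub>R c" by auto
    have l: "0 \<le> (1 - v) / (1 - v1)" "(1 - v) / (1 - v1) \<le> 1" using that v1 v2 by (auto simp: field_simps)
    have "((1 - v) / (1 - v1)) *\<^sub>R c + (1 - (1 - v) / (1 - v1)) *\<^sub>R 0 \<in> rs_body K"
      using l c rs_body_axis[of 0] by (intro convexD[OF convex_rs_body]) (auto simp: zero_prod_def)
    moreover have "x = (1 - v1) *\<^sub>R (((1 - v) / (1 - v1)) *\<^sub>R c)" using c v1 v2 by simp
    ultimately show "x \<in> (*\<^sub>R) (1 - v1) ` rs_body K" by (metis add.right_neutral image_eqI scaleR_zero_right)
  qed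
  have "s *\<^sub>R w \<notin> (*\<^sub>R) (1 - v1) ` rs_body K"
  proof
    assume "s *\<^sub>R w \<in> (*\<^sub>R) (1 - v1) ` rs_body K"
    then obtain c where c: "c \<in> rs_body K" "s *\<^sub>R w = (1 - v1) *\<^sub>R c" by auto
    have "(s / (1 - v1)) *\<^sub>R w = (1 / (1 - v1)) *\<^sub>R (s *\<^sub>R w)" by simp
    also have "\<dots> = c" unfolding c(2) using v1 v2 by simp
    finally have "(s / (1 - v1)) *\<^sub>R w \<in> rs_body K" using c by simp
    moreover have "1 < s / (1 - v1)" using v1 v2 by (simp add: field_simps)
    ultimately show False using w(2) by blast
  qed
  moreover have "closed ((*\<^sub>R) (1 - v1) ` rs_body K)"
    using compact_rs_body by (intro compact_imp_closed compact_scaling)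
  ultimately obtain r' where r': "r' > 0" "ball (s *\<^sub>R w) r' \<inter> (*\<^sub>R) (1 - v1) ` rs_body K = {}"
    by (metis Compl_disjoint open_Compl ComplI open_contains_ball disjoint_eq_subset_Compl)
  (* The ball of radius (1 - s)r around sw lies in the body, so a point at distance less than e(1 - s)r
     from sw is (1 - e)sw + ez' with z' in the body. *)
  define r0 where "r0 = min r' (e * (1 - s) * r)"
  have r0: "r0 > 0" using r' e s r by (simp add: r0_def)
  have big: "v2 ^ n * ?F 0 \<le> ?F z" if "z \<in> ball (s *\<^sub>R w) r0" for z
  proof -
    define u where "u = z - s *\<^sub>R w"
    have "norm u < e * (1 - s) * r" using that by (simp add: u_def r0_def dist_norm norm_minus_commute)
    then have "norm ((1 / (e * (1 - s))) *\<^sub>R u) < r" using e s by (simp add: field_simps)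
    then have "(1 / (e * (1 - s))) *\<^sub>R u \<in> rs_body K" using r by auto
    then have "s *\<^sub>R w + (1 - s) *\<^sub>R ((1 / (e * (1 - s))) *\<^sub>R u) \<in> rs_body K"
      using w(1) s by (intro convexD[OF convex_rs_body]) auto
    moreover have "(1 - s) *\<^sub>R ((1 / (e * (1 - s))) *\<^sub>R u) = (1 / e) *\<^sub>R u" using s by simp
    ultimately have z': "s *\<^sub>R w + (1 / e) *\<^sub>R u \<in> rs_body K" by (simp only:)
    have "s *\<^sub>R w + (1 - s) *\<^sub>R 0 \<in> rs_body K"
      using w(1) s rs_body_axis[of 0] by (intro convexD[OF convex_rs_body]) (auto simp: zero_prod_def)
    then have "(1 - e) ^ n * ?F (s *\<^sub>R w) \<le> ?F ((1 - e) *\<^sub>R (s *\<^sub>R w) + e *\<^sub>R (s *\<^sub>R w + (1 / e) *\<^sub>R u))"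
      unfolding n_def using e z' by (intro overlap_volume_nearby) auto
    also have "(1 - e) *\<^sub>R (s *\<^sub>R w) + e *\<^sub>R (s *\<^sub>R w + (1 / e) *\<^sub>R u) = z"
      using e by (simp add: u_def algebra_simps)
    finally show ?thesis using eF by simp
  qed
  define c where "c = real ((DIM('a) + Suc DIM('a)) choose DIM('a))"
  have c: "c > 0" by (simp add: c_def)
  let ?U = "ball (s *\<^sub>R w) r0"
  have gap: "ennreal (1 / c) * emeasure (lborel \<Otimes>\<^sub>M lborel) (rs_body K)
          + ennreal (v2 ^ DIM('a) - v1 ^ DIM('a)) * emeasure (lborel \<Otimes>\<^sub>M lborel) ?U
    \<le> ennreal (1 / c * (2 ^ DIM('a) / (real DIM('a) + 1))) * ennreal vol_K"
    unfolding c_def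
  proof (rule rs_body_measure_gap[OF radial_measure_lborel])
    show "emeasure lborel ((\<lambda>x. (1 - \<theta>) *\<^sub>R y - \<theta> *\<^sub>R x) ` K) \<le> ennreal vol_K * ennreal (\<theta> ^ DIM('a))"
      if "0 < \<theta>" for y \<theta> using reflected_copy_volume[OF that] by simp
    show "v ^ DIM('a) * ?F 0 \<le> ?F z \<and> z \<notin> (*\<^sub>R) (1 - v) ` rs_body K"
      if "v1 \<le> v" "v \<le> v2" "z \<in> ?U" for v z
    proof
      have "v ^ n * ?F 0 \<le> v2 ^ n * ?F 0" using that F0 v1 s by (intro mult_right_mono power_mono) auto
      also have "\<dots> \<le> ?F z" using big[OF that(3)] .
      finally show "v ^ DIM('a) * ?F 0 \<le> ?F z" by (simp add: n_def)
      have "z \<in> ball (s *\<^sub>R w) r'" using that by (simp add: r0_def)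
      then show "z \<notin> (*\<^sub>R) (1 - v) ` rs_body K" using sub[of v] that(1,2) r'(2) v2
        by (metis (no_types, lifting) disjoint_iff le_less_trans less_le_trans min.strict_boundedE subsetD)
    qed
  qed (use v1 v2 s in auto)
  have upper: "ennreal (1 / c * (2 ^ DIM('a) / (real DIM('a) + 1))) * ennreal vol_K
      \<le> ennreal (1 / c) * emeasure lborel (rs_body K)"
  proof -
    have "ennreal (1 / c * (2 ^ DIM('a) / (real DIM('a) + 1)))
        = ennreal (1 / c) * ennreal (2 ^ DIM('a) / (real DIM('a) + 1))"
      using c by (intro ennreal_mult) auto
    then show ?thesis using mult_left_mono[OF eq, of "ennreal (1 / c)"] by (simp only: mult.assoc zero_le)
  qed
  have "emeasure lborel (rs_body K) < \<infinity>" using emeasure_compact_finite[OF compact_rs_body] by simp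
  have "0 < v2 ^ DIM('a) - v1 ^ DIM('a)"
    using v1 s n by (simp add: power_strict_mono n_def)
  have "emeasure lborel ?U > 0"
    using r0 content_ball_pos[of r0 "s *\<^sub>R w"] emeasure_lborel_ball_finite[of "s *\<^sub>R w" r0]
    by (simp add: emeasure_eq_ennreal_measure)
  have "ennreal (1 / c) * emeasure lborel (rs_body K)
        + ennreal (v2 ^ DIM('a) - v1 ^ DIM('a)) * emeasure lborel ?U
      \<le> ennreal (1 / c) * emeasure lborel (rs_body K) + 0"
    using order_trans[OF gap[unfolded lborel_prod] upper] by (simp only: add_0_right)
  then have "ennreal (v2 ^ DIM('a) - v1 ^ DIM('a)) * emeasure lborel ?U \<le> 0"
    using \<open>emeasure lborel (rs_body K) < \<infinity>\<close>
    by (subst (asm) ennreal_add_left_cancel_le) (auto simp: ennreal_mult_eq_top_iff)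
  with \<open>0 < v2 ^ DIM('a) - v1 ^ DIM('a)\<close> \<open>emeasure lborel ?U > 0\<close> show False by simp
qed

text \<open>
  Inclusion of convex bodies of equal volume is equality.
\<close>

lemma overlap_eq_homothet:
  assumes eq: "ennreal (2 ^ DIM('a) / (real DIM('a) + 1)) * ennreal vol_K \<le> emeasure lborel (rs_body K)"
    and w: "\<And>c. 1 < c \<Longrightarrow> c *\<^sub>R w \<notin> rs_body K" and y: "y \<in> overlap K w" and s: "0 < s" "s < 1"
  shows "overlap K (s *\<^sub>R w) = (\<lambda>k. s *\<^sub>R y + ((1 - s) / 2) *\<^sub>R k) ` K"
proof (rule compact_convex_eq_of_measure_eq)
  have wC: "w \<in> rs_body K" using y by (auto simp: rs_body_def)
  have m: "measure lborel ((\<lambda>k. s *\<^sub>R y + ((1 - s) / 2) *\<^sub>R k) ` K) = ((1 - s) / 2) ^ DIM('a) * vol_K"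
    using s by (subst measure_affine_image) auto
  then show "measure lborel (overlap K (s *\<^sub>R w)) \<le> measure lborel ((\<lambda>k. s *\<^sub>R y + ((1 - s) / 2) *\<^sub>R k) ` K)"
    using overlap_volume_of_equality[OF eq wC w s] by (simp add: overlap_volume_0 power_divide)
  show "(\<lambda>k. s *\<^sub>R y + ((1 - s) / 2) *\<^sub>R k) ` K \<subseteq> overlap K (s *\<^sub>R w)"
    using s by (intro overlap_scaleR[OF y]) auto
  show "compact ((\<lambda>k. s *\<^sub>R y + ((1 - s) / 2) *\<^sub>R k) ` K)"
    by (intro compact_continuous_image compact_K continuous_intros)
  show "interior (overlap K (s *\<^sub>R w)) \<noteq> {}"
  proof
    assume "interior (overlap K (s *\<^sub>R w)) = {}"
    then have "negligible (overlap K (s *\<^sub>R w))"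
      using convex_overlap by (metis negligible_convex_interior)
    then have "measure lebesgue (overlap K (s *\<^sub>R w)) = 0" by (rule negligible_imp_measure0)
    then have "measure lborel (overlap K (s *\<^sub>R w)) = 0"
      using compact_overlap by (simp add: borel_compact)
    moreover have "0 < (1 - s) ^ DIM('a) * measure lborel (overlap K 0)"
      using s vol_K_pos by (simp add: overlap_volume_0)
    ultimately show False using overlap_volume_scaleR[OF wC, of s] s by linarith
  qed
qed (rule compact_overlap convex_overlap)+

lemma last_multiple_in_rs_body:
  assumes "d \<noteq> 0"
  obtains s where "0 < s" "s *\<^sub>R d \<in> rs_body K" "\<And>c. s < c \<Longrightarrow> c *\<^sub>R d \<notin> rs_body K"
proof -
  obtain r where r: "r > 0" "ball 0 r \<subseteq> rs_body K" using zero_interior_rs_body by (auto simp: mem_interior)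
  obtain R where R: "R > 0" "\<And>z. z \<in> rs_body K \<Longrightarrow> norm z \<le> R"
    using compact_imp_bounded[OF compact_rs_body] bounded_pos by metis
  define A where "A = (\<lambda>s. s *\<^sub>R d) -` rs_body K \<inter> {0..R / norm d}"
  have "closed ((\<lambda>s. s *\<^sub>R d) -` rs_body K)"
    by (intro continuous_closed_vimage compact_imp_closed compact_rs_body) (auto intro!: continuous_intros)
  then have "compact A" unfolding A_def by (simp add: closed_Int_compact)
  have in_A: "s \<in> A" if "0 \<le> s" "s *\<^sub>R d \<in> rs_body K" for s
    using that R(2)[OF that(2)] assms by (auto simp: A_def field_simps)
  define s0 where "s0 = r / (2 * norm d)"
  have s0: "s0 > 0" using r assms by (simp add: s0_def)
  have "s0 *\<^sub>R d \<in> ball 0 r" using r assms by (simp add: s0_def)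
  then have "s0 \<in> A" using r s0 by (intro in_A) auto
  then obtain s where s: "s \<in> A" "\<And>t. t \<in> A \<Longrightarrow> t \<le> s"
    using compact_attains_sup[OF \<open>compact A\<close>] by blast
  have "s > 0" using s(2)[OF \<open>s0 \<in> A\<close>] s0 by simp
  show ?thesis
  proof (rule that)
    show "s *\<^sub>R d \<in> rs_body K" using s by (simp add: A_def)
    show "c *\<^sub>R d \<notin> rs_body K" if "s < c" for c
      using in_A[of c] s(2)[of c] that \<open>s > 0\<close> by auto
  qed fact
qed

text \<open>
  A pair \<open>z, z - p\<close> in the cone is, after normalising the sum \<open>T\<close> of the two heights, a point of the
  overlap at \<open>d/T\<close>, where the direction \<open>d\<close> depends on \<open>p\<close> only. So the heights \<open>T\<close> run along one
  ray in \<open>C\<close>, from its last point \<open>w\<close>, which gives the join \<open>q\<close>, inwards; and by equality the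
  overlaps along this ray are the slices of \<open>q + Q\<close>.
\<close>

lemma cone_join_of_equality:
  assumes eq: "ennreal (2 ^ DIM('a) / (real DIM('a) + 1)) * ennreal vol_K \<le> emeasure lborel (rs_body K)"
  shows "\<exists>q. q \<in> Q \<and> q - p \<in> Q \<and> (\<forall>z. z \<in> Q \<and> z - p \<in> Q \<longrightarrow> z - q \<in> Q)"
proof (cases "p = 0")
  case True
  then show ?thesis using zero_cone by (intro exI[of _ 0]) auto
next
  case False
  obtain p' \<sigma> where p: "p = (p', \<sigma>)" by (cases p)
  define d where "d = (p', - \<sigma> / 2)"
  have "d \<noteq> 0" using False p by (auto simp: d_def zero_prod_def)
  then obtain s0 where s0: "0 < s0" "s0 *\<^sub>R d \<in> rs_body K" "\<And>c. s0 < c \<Longrightarrow> c *\<^sub>R d \<notin> rs_body K"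
    using last_multiple_in_rs_body by blast
  define w where "w = s0 *\<^sub>R d"
  have w: "c *\<^sub>R w \<notin> rs_body K" if "1 < c" for c
    using s0(3)[of "c * s0"] that s0(1) by (simp add: w_def)
  obtain y where y: "y \<in> overlap K w" using s0 by (auto simp: w_def rs_body_def)
  define T0 where "T0 = 1 / s0"
  have T0: "T0 > 0" "T0 * s0 = 1" using s0 by (simp_all add: T0_def)
  define q where "q = (T0 *\<^sub>R y, (T0 + \<sigma>) / 2)"
  have "T0 *\<^sub>R (y, 1/2 - snd w) \<in> Q" "T0 *\<^sub>R (y - fst w, 1/2 + snd w) \<in> Q"
    using y T0 by (auto simp: overlap_def intro!: cone_over_scaleR simp del: scaleR_Pair)
  moreover have "T0 *\<^sub>R (y, 1/2 - snd w) = q" "T0 *\<^sub>R (y - fst w, 1/2 + snd w) = q - p"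
    using s0 by (auto simp: q_def p w_def d_def T0_def algebra_simps field_simps)
  ultimately have q: "q \<in> Q" "q - p \<in> Q" by auto
  have *: "z - q \<in> Q" if z: "z \<in> Q" "z - p \<in> Q" and big: "2 * snd z - \<sigma> > T0" for z
  proof -
    obtain a t where at: "z = (a, t)" by (cases z)
    define T where "T = 2 * t - \<sigma>"
    have T: "T > T0" "T > 0" using big at T0 by (auto simp: T_def)
    have "(1 / T) *\<^sub>R (a, t) \<in> Q" "(1 / T) *\<^sub>R (a - p', t - \<sigma>) \<in> Q"
      using z at p T by (auto intro!: cone_over_scaleR simp del: scaleR_Pair)
    moreover have "t / T = 1/2 - snd ((1 / T) *\<^sub>R d)" "(t - \<sigma>) / T = 1/2 + snd ((1 / T) *\<^sub>R d)"
      using T by (simp_all add: d_def T_def field_simps)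
    ultimately have "(1 / T) *\<^sub>R a \<in> overlap K ((1 / T) *\<^sub>R d)"
      by (simp add: overlap_def d_def scaleR_diff_right)
    also have "(1 / T) *\<^sub>R d = (T0 / T) *\<^sub>R w" using T0 by (simp add: w_def)
    also have "overlap K ((T0 / T) *\<^sub>R w) = (\<lambda>k. (T0 / T) *\<^sub>R y + ((1 - T0 / T) / 2) *\<^sub>R k) ` K"
      using T T0 by (intro overlap_eq_homothet[OF eq w y]) auto
    finally obtain k where k: "k \<in> K" "(1 / T) *\<^sub>R a = (T0 / T) *\<^sub>R y + ((1 - T0 / T) / 2) *\<^sub>R k" by auto
    have "a = T *\<^sub>R ((1 / T) *\<^sub>R a)" using T by simp
    also have "\<dots> = T0 *\<^sub>R y + ((T - T0) / 2) *\<^sub>R k"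
      unfolding k(2) using T by (simp add: scaleR_add_right right_diff_distrib)
    finally have "z - q = ((T - T0) / 2) *\<^sub>R (k, 1)" by (simp add: at q_def T_def field_simps)
    moreover have "(k, 1) \<in> Q" using k by (auto simp: cone_over_iff)
    ultimately show ?thesis using T cone_over_scaleR[of "(k, 1)" K "(T - T0) / 2"] by simp
  qed
  have "z - q \<in> Q" if z: "z \<in> Q" "z - p \<in> Q" for z
  proof -
    obtain a t where at: "z = (a, t)" by (cases z)
    have "2 * t - \<sigma> \<ge> T0"
    proof (cases "2 * t - \<sigma> = 0")
      case True
      then have "t = 0" "\<sigma> = 0" using z at p by (auto simp: cone_over_iff)
      then have "p = 0" using z at p by (auto simp: cone_over_iff zero_prod_def)
      then show ?thesis using False by simp
    next
      case nz: False
      define T where "T = 2 * t - \<sigma>"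
      have T: "T > 0" using z at p nz by (auto simp: cone_over_iff T_def)
      have "(1 / T) *\<^sub>R (a, t) \<in> Q" "(1 / T) *\<^sub>R (a - p', t - \<sigma>) \<in> Q"
        using z at p T by (auto intro!: cone_over_scaleR simp del: scaleR_Pair)
      moreover have "t / T = 1/2 - snd ((1 / T) *\<^sub>R d)" "(t - \<sigma>) / T = 1/2 + snd ((1 / T) *\<^sub>R d)"
        using T by (simp_all add: d_def T_def field_simps)
      ultimately have "(1 / T) *\<^sub>R a \<in> overlap K ((1 / T) *\<^sub>R d)"
        by (simp add: overlap_def d_def scaleR_diff_right)
      then have "(1 / T) *\<^sub>R d \<in> rs_body K" by (auto simp: rs_body_def)
      then have "1 / T \<le> s0" using s0(3) not_le by blast
      then show ?thesis using T s0 by (simp add: T_def T0_def field_simps)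
    qed
    (* On the boundary of the body the homothet degenerates to a point; raising z along the axis of the
       cone moves inside, and closedness of the cone brings the conclusion back. *)
    have "(z + (0, inverse (real (Suc n)))) - q \<in> Q" for n
    proof (rule *)
      let ?v = "(0, inverse (real (Suc n))) :: 'a \<times> real"
      have v: "?v \<in> Q" by (rule cone_axis) simp
      show "z + ?v \<in> Q" by (rule cone_add[OF z(1) v])
      show "z + ?v - p \<in> Q" using cone_add[OF z(2) v] by (simp only: diff_add_eq)
      have "0 < inverse (real (Suc n))" by simp
      moreover have "snd (z + ?v) = t + inverse (real (Suc n))" by (simp add: at)
      ultimately show "T0 < 2 * snd (z + ?v) - \<sigma>" using \<open>2 * t - \<sigma> \<ge> T0\<close> by linarith
    qed
    moreover have "(\<lambda>n. (z + (0, inverse (real (Suc n)))) - q) \<longlonglongrightarrow> (z + (0, 0)) - q"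
      by (intro tendsto_intros LIMSEQ_inverse_real_of_nat)
    ultimately have "(z + (0, 0)) - q \<in> Q" by (rule closed_sequentially[OF closed_cone])
    then show ?thesis by (simp add: zero_prod_def[symmetric])
  qed
  with q show ?thesis by blast
qed

lemma cone_over_extreme_ray:
  assumes e: "e extreme_point_of K" and q: "q \<in> Q" "\<alpha> *\<^sub>R (e, 1) - q \<in> Q" and "0 < \<alpha>"
  shows "q = snd q *\<^sub>R (e, 1)"
proof -
  obtain x \<gamma> where q': "q = (x, \<gamma>)" by (cases q)
  obtain k where k: "k \<in> K" "x = \<gamma> *\<^sub>R k" "0 \<le> \<gamma>" using q q' by (auto simp: cone_over_iff)
  obtain k' where k': "k' \<in> K" "\<alpha> *\<^sub>R e - x = (\<alpha> - \<gamma>) *\<^sub>R k'" "0 \<le> \<alpha> - \<gamma>"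
    using q q' by (auto simp: cone_over_iff)
  consider "\<gamma> = 0" | "\<gamma> = \<alpha>" | "0 < \<gamma>" "\<gamma> < \<alpha>" using k k' by linarith
  then have "x = \<gamma> *\<^sub>R e"
  proof cases
    case 3
    define u where "u = \<gamma> / \<alpha>"
    have u: "0 < u" "u < 1" using 3 assms by (auto simp: u_def)
    have "\<alpha> *\<^sub>R e = \<gamma> *\<^sub>R k + (\<alpha> - \<gamma>) *\<^sub>R k'" using k k' by (simp add: algebra_simps)
    then have "(1 / \<alpha>) *\<^sub>R (\<alpha> *\<^sub>R e) = (1 / \<alpha>) *\<^sub>R (\<gamma> *\<^sub>R k + (\<alpha> - \<gamma>) *\<^sub>R k')" by simp
    then have eu: "e = (1 - u) *\<^sub>R k' + u *\<^sub>R k"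
      using \<open>0 < \<alpha>\<close> by (simp add: u_def scaleR_add_right diff_divide_distrib)
    have "k' = k"
    proof (rule ccontr)
      assume "k' \<noteq> k"
      then have "e \<in> open_segment k' k" using u eu by (auto simp: in_segment)
      then show False using e k k' by (auto simp: extreme_point_of_def)
    qed
    then have "e = k" using eu by (simp add: scaleR_left_distrib[symmetric])
    then show ?thesis using k by simp
  qed (use k k' in auto)
  then show ?thesis by (simp add: q')
qed

text \<open>
  Riesz decomposition: if \<open>a \<le> b1 + b2\<close> with \<open>a\<close> on the ray of \<open>e\<close> and \<open>b1\<close> on the ray of \<open>f\<close>, the
  join \<open>q\<close> of \<open>0\<close> and \<open>a - b2\<close> lies below both \<open>a\<close> and \<open>b1\<close>. Lying on two different extreme rays
  it vanishes, so \<open>a \<le> b2\<close>, and the rays can be removed one at a time.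
\<close>

lemma extreme_ray_not_below_others:
  assumes join: "\<And>p. \<exists>q. q \<in> Q \<and> q - p \<in> Q \<and> (\<forall>z. z \<in> Q \<and> z - p \<in> Q \<longrightarrow> z - q \<in> Q)"
    and e: "e extreme_point_of K" and \<alpha>: "0 < \<alpha>"
    and J: "finite J" "\<And>f. f \<in> J \<Longrightarrow> f extreme_point_of K" "e \<notin> J" "\<And>f. f \<in> J \<Longrightarrow> 0 < \<beta> f"
  shows "(\<Sum>f\<in>J. \<beta> f *\<^sub>R (f, 1)) - \<alpha> *\<^sub>R (e, 1) \<notin> Q"
  using J
proof (induction J rule: finite_induct)
  case empty
  then show ?case using \<alpha> by (auto simp: cone_over_iff)
next
  case (insert f J)
  let ?a = "\<alpha> *\<^sub>R (e, 1)" and ?b1 = "\<beta> f *\<^sub>R (f, 1)" and ?b2 = "\<Sum>f\<in>J. \<beta> f *\<^sub>R (f, 1)"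
  have K: "g \<in> K" if "g extreme_point_of K" for g using that by (simp add: extreme_point_of_def)
  have Q1: "c *\<^sub>R (g, 1) \<in> Q" if "g extreme_point_of K" "0 < c" for g c
    using K[OF that(1)] that(2) by (intro cone_over_scaleR) (auto simp: cone_over_iff)
  have b2: "?b2 \<in> Q"
    using insert.prems Q1 by (intro sum_in_cone) auto
  show ?case
  proof
    assume "(\<Sum>f\<in>insert f J. \<beta> f *\<^sub>R (f, 1)) - ?a \<in> Q"
    then have A: "?b1 + ?b2 - ?a \<in> Q" using insert.hyps by simp
    obtain q where q: "q \<in> Q" "q - (?a - ?b2) \<in> Q" "\<And>z. z \<in> Q \<Longrightarrow> z - (?a - ?b2) \<in> Q \<Longrightarrow> z - q \<in> Q"
      using join[of "?a - ?b2"] by blast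
    have "?a - q \<in> Q" using Q1[OF e \<alpha>] b2 by (intro q(3)) (simp_all del: scaleR_Pair)
    then have qe: "q = snd q *\<^sub>R (e, 1)" by (intro cone_over_extreme_ray[OF e q(1) _ \<alpha>])
    have f: "f extreme_point_of K" "0 < \<beta> f" "f \<noteq> e" using insert.prems by auto
    have "?b1 - q \<in> Q" using Q1[OF f(1,2)] A by (intro q(3)) (simp_all add: algebra_simps del: scaleR_Pair)
    then have qf: "q = snd q *\<^sub>R (f, 1)" by (intro cone_over_extreme_ray[OF f(1) q(1) _ f(2)])
    from qe qf have "fst q = snd q *\<^sub>R e" "fst q = snd q *\<^sub>R f" by (metis fst_conv fst_scaleR)+
    then have "snd q = 0" using f(3) by simp
    then have "q = 0" using qe by (simp add: zero_prod_def)
    then have "?b2 - ?a \<in> Q" using q(2) by simp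
    moreover have "?b2 - ?a \<notin> Q" using insert.prems by (intro insert.IH) auto
    ultimately show False by simp
  qed
qed

text \<open>
  In an affine dependence among extreme points, move the negative coefficients to the other side:
  a point \<open>e\<close> with positive coefficient is then dominated by a combination of other extreme points.
\<close>

lemma simplex_of_cone_joins:
  assumes join: "\<And>p. \<exists>q. q \<in> Q \<and> q - p \<in> Q \<and> (\<forall>z. z \<in> Q \<and> z - p \<in> Q \<longrightarrow> z - q \<in> Q)"
  shows "int DIM('a) simplex K"
proof -
  define X where "X = {x. x extreme_point_of K}"
  have "\<not> affine_dependent X"
  proof
    assume "affine_dependent X"
    then obtain S u where S: "finite S" "S \<subseteq> X" "sum u S = 0" "\<exists>v\<in>S. u v \<noteq> 0" "(\<Sum>v\<in>S. u v *\<^sub>R v) = 0"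
      unfolding affine_dependent_explicit by auto
    have "\<exists>e\<in>S. u e > 0"
    proof (rule ccontr)
      assume "\<not> ?thesis"
      then have "\<forall>v\<in>S. - u v \<ge> 0" by force
      moreover have "sum (\<lambda>v. - u v) S = 0" using S by (simp add: sum_negf)
      ultimately have "\<forall>v\<in>S. - u v = 0" using sum_nonneg_eq_0_iff[OF S(1), of "\<lambda>v. - u v"] by simp
      then show False using S by auto
    qed
    then obtain e where e: "e \<in> S" "u e > 0" by auto
    define J where "J = {v\<in>S. u v < 0}"
    define L where "L = {v\<in>S. u v \<ge> 0} - {e}"
    have dec: "S = insert e (J \<union> L)" "e \<notin> J \<union> L" "J \<inter> L = {}" "finite J" "finite L"
      using e S by (auto simp: J_def L_def)
    have solve: "- b - a = c" if "a + (b + c) = 0" for a b c :: "'a \<times> real"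
    proof -
      have "(a + b) + c = 0" using that by (simp add: add.assoc)
      from minus_unique[OF this] have "- (a + b) = c" .
      moreover have "- b - a = - (a + b)" by simp
      ultimately show ?thesis by (rule trans[rotated])
    qed
    have tot: "(\<Sum>v\<in>S. u v *\<^sub>R (v, 1::real)) = 0"
      using S by (simp add: prod_eq_iff fst_sum snd_sum)
    have "(\<Sum>v\<in>S. u v *\<^sub>R (v, 1::real)) = u e *\<^sub>R (e, 1) + ((\<Sum>v\<in>J. u v *\<^sub>R (v, 1)) + (\<Sum>v\<in>L. u v *\<^sub>R (v, 1)))"
      using dec by (simp add: sum.union_disjoint del: scaleR_Pair)
    then have "(\<Sum>v\<in>J. (- u v) *\<^sub>R (v, 1)) - u e *\<^sub>R (e, 1::real) = (\<Sum>v\<in>L. u v *\<^sub>R (v, 1))"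
      using tot solve by (simp add: sum_negf del: scaleR_Pair)
    moreover have "(\<Sum>v\<in>L. u v *\<^sub>R (v, 1)) \<in> Q"
    proof (rule sum_in_cone)
      fix v assume "v \<in> L"
      then have "v \<in> K" "u v \<ge> 0" using S by (auto simp: L_def X_def extreme_point_of_def)
      then show "u v *\<^sub>R (v, 1) \<in> Q" by (intro cone_over_scaleR) (auto simp: cone_over_iff)
    qed
    moreover have "(\<Sum>v\<in>J. (- u v) *\<^sub>R (v, 1)) - u e *\<^sub>R (e, 1) \<notin> Q"
      using e S(1,2) by (intro extreme_ray_not_below_others[OF join]) (auto simp: J_def X_def)
    ultimately show False by simp
  qed
  moreover have KX: "K = convex hull X"
    unfolding X_def by (rule Krein_Milman_Minkowski[OF compact_K convex_K])
  moreover have "int (card X) = int DIM('a) + 1"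
  proof -
    have "aff_dim K = int DIM('a)" using interior_K by (simp add: aff_dim_nonempty_interior)
    then have "aff_dim X = int DIM('a)" using KX by (metis aff_dim_convex_hull)
    then show ?thesis using aff_dim_affine_independent[OF \<open>\<not> affine_dependent X\<close>] by simp
  qed
  ultimately show ?thesis unfolding simplex_def by blast
qed

end

section \<open>Simplices attain equality\<close>

lemma homogeneous_levels:
  fixes g :: "'b::real_vector \<Rightarrow> real"
  assumes hom: "\<And>s x. 0 \<le> s \<Longrightarrow> g (s *\<^sub>R x) = s * g x" and v: "v < 1"
  shows "{x. v \<le> 1 - g x} = (*\<^sub>R) (1 - v) ` {x. 0 \<le> 1 - g x}"
proof (intro equalityI subsetI)
  fix x assume x: "x \<in> {x. v \<le> 1 - g x}"
  let ?y = "(1 / (1 - v)) *\<^sub>R x"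
  have "g ?y \<le> 1" using x v by (subst hom) (auto simp: field_simps)
  then show "x \<in> (*\<^sub>R) (1 - v) ` {x. 0 \<le> 1 - g x}" using v by (intro image_eqI[of _ _ ?y]) auto
next
  fix x assume "x \<in> (*\<^sub>R) (1 - v) ` {x. 0 \<le> 1 - g x}"
  then obtain y where y: "x = (1 - v) *\<^sub>R y" "g y \<le> 1" by auto
  have "(1 - v) * g y \<le> (1 - v) * 1" using y v by (intro mult_left_mono) auto
  moreover have "g x = (1 - v) * g y" using y v by (simp add: hom)
  ultimately show "x \<in> {x. v \<le> 1 - g x}" by simp
qed

text \<open>
  At height one the vertices of an \<open>n\<close>-simplex form a basis of \<open>\<real>\<^sup>n \<times> \<real>\<close>; the dual basis restricts
  to the barycentric coordinates at height one and makes them linear.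
\<close>

lemma lifted_barycentric_coordinates:
  fixes V :: "'a::euclidean_space set"
  assumes indep: "\<not> affine_dependent V" and card: "card V = DIM('a) + 1"
  obtains f :: "'a \<Rightarrow> 'a \<times> real \<Rightarrow> real"
  where "\<And>v. linear (f v)" "\<forall>v\<in>V. \<forall>u\<in>V. f v (u, 1) = (if u = v then 1 else 0)"
    "\<And>z. (\<Sum>v\<in>V. f v z *\<^sub>R (v, 1)) = z"
proof -
  have fin: "finite V" by (rule aff_independent_finite[OF indep])
  define B where "B = (\<lambda>v. (v, 1::real)) ` V"
  have inj: "inj_on (\<lambda>v. (v, 1::real)) V" by (simp add: inj_on_def)
  have B: "finite B" "card B = DIM('a \<times> real)" using fin card inj by (simp_all add: B_def card_image)
  have "independent B"
  proof (rule ccontr)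
    assume "\<not> independent B"
    then obtain u where u: "\<exists>b\<in>B. u b \<noteq> 0" "(\<Sum>b\<in>B. u b *\<^sub>R b) = 0"
      using dependent_finite[OF B(1)] by blast
    have "(\<Sum>v\<in>V. u (v, 1) *\<^sub>R (v, 1::real)) = 0" using u(2) inj by (simp add: B_def sum.reindex)
    then have "(\<Sum>v\<in>V. u (v, 1) *\<^sub>R v) = 0" "(\<Sum>v\<in>V. u (v, 1)) = 0"
      by (simp_all add: prod_eq_iff fst_sum snd_sum)
    then have "affine_dependent V"
      unfolding affine_dependent_explicit_finite[OF fin] using u(1) by (intro exI[of _ "\<lambda>v. u (v, 1)"]) (auto simp: B_def)
    then show False using indep by simp
  qed
  have "\<forall>v. \<exists>g::'a \<times> real \<Rightarrow> real. linear g \<and> (\<forall>b\<in>B. g b = (if fst b = v then 1 else 0))"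
  proof
    fix v
    show "\<exists>g::'a \<times> real \<Rightarrow> real. linear g \<and> (\<forall>b\<in>B. g b = (if fst b = v then 1 else 0))"
      by (rule linear_independent_extend[OF \<open>independent B\<close>])
  qed
  then obtain f where f: "\<And>v. linear (f v :: 'a \<times> real \<Rightarrow> real)"
      "\<And>v b. b \<in> B \<Longrightarrow> f v b = (if fst b = v then 1 else 0)"
    by metis
  have fV: "f v (u, 1) = (if u = v then 1 else 0)" if "u \<in> V" for u v
    using f(2)[of "(u, 1)" v] that by (auto simp: B_def)
  have "(\<Sum>v\<in>V. f v z *\<^sub>R (v, 1)) = z" for z
  proof -
    have lin: "linear (\<lambda>z. \<Sum>v\<in>V. f v z *\<^sub>R (v, 1::real))"
      by (rule linearI) (simp_all add: linear_add[OF f(1)] linear_cmul[OF f(1)] scaleR_left_distrib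
          sum.distrib scaleR_sum_right del: scaleR_Pair)
    have "UNIV \<subseteq> span B"
      by (rule card_ge_dim_independent) (use \<open>independent B\<close> B in auto)
    moreover have "(\<Sum>v\<in>V. f v b *\<^sub>R (v, 1)) = id b" if "b \<in> B" for b
    proof -
      obtain u where u: "u \<in> V" "b = (u, 1)" using \<open>b \<in> B\<close> unfolding B_def by blast
      have "(\<Sum>v\<in>V. f v b *\<^sub>R (v, 1)) = (\<Sum>v\<in>V. if v = u then (v, 1) else 0)"
        using u fV by (intro sum.cong) (auto simp: zero_prod_def)
      also have "\<dots> = id b" using u fin by (simp add: sum.delta)
      finally show ?thesis .
    qed
    ultimately show ?thesis
      using linear_eq_on_span[OF lin linear_id, of B z] by auto
  qed
  then show ?thesis using fV by (intro that[of f] f(1)) auto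
qed

text \<open>
  In the coordinates \<open>f\<close>, an intersection of two translates of the cone over a simplex is taken by
  coordinatewise minima. This sum of minima, which is positively homogeneous and nonpositive, is the
  amount by which the size of the overlap at \<open>z\<close> changes from the central value \<open>1/2\<close>.
\<close>

definition coordinate_loss ::
  "'a set \<Rightarrow> ('a \<Rightarrow> 'a \<times> real \<Rightarrow> real) \<Rightarrow> 'a::euclidean_space \<times> real \<Rightarrow> real" where
  "coordinate_loss V f z = (\<Sum>v\<in>V. min (f v (0, - snd z)) (f v (- fst z, snd z)))"

context convex_body_with_origin
begin

lemma cone_over_simplex_iff:
  assumes V: "finite V" "K = convex hull V" and f: "\<And>v. linear (f v)"
    "\<forall>v\<in>V. \<forall>u\<in>V. f v (u, 1) = (if u = v then 1 else 0)"
    "\<And>z. (\<Sum>v\<in>V. f v z *\<^sub>R (v, 1)) = z"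
  shows "z \<in> Q \<longleftrightarrow> (\<forall>v\<in>V. (0::real) \<le> f v z)"
proof
  assume "z \<in> Q"
  then obtain k t where k: "k \<in> K" "0 \<le> t" "z = t *\<^sub>R (k, 1)" by (cases z) (auto simp: cone_over_iff)
  obtain u where u: "\<And>v. v \<in> V \<Longrightarrow> 0 \<le> u v" "sum u V = 1" "(\<Sum>v\<in>V. u v *\<^sub>R v) = k"
    using k(1) V convex_hull_finite[OF V(1)] by auto
  have k1: "(k, 1) = (\<Sum>v\<in>V. u v *\<^sub>R (v, 1::real))" using u by (simp add: prod_eq_iff fst_sum snd_sum)
  show "\<forall>v\<in>V. 0 \<le> f v z"
  proof
    fix w assume w: "w \<in> V"
    have "f w (k, 1) = (\<Sum>v\<in>V. u v * f w (v, 1))"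
      unfolding k1 linear_sum[OF f(1)] linear_cmul[OF f(1)] by simp
    also have "\<dots> = (\<Sum>v\<in>V. if v = w then u v else 0)" using f(2) w by (intro sum.cong) auto
    also have "\<dots> = u w" using w V by simp
    finally show "0 \<le> f w z" using u(1)[OF w] k(2) unfolding k(3) linear_cmul[OF f(1)] by simp
  qed
next
  assume "\<forall>v\<in>V. 0 \<le> f v z"
  then have "(\<Sum>v\<in>V. f v z *\<^sub>R (v, 1)) \<in> Q"
    using V by (intro sum_in_cone cone_over_scaleR) (auto simp: cone_over_iff intro: hull_inc)
  then show "z \<in> Q" by (simp only: f(3))
qed

text \<open>
  The overlap at \<open>z\<close> is described by one inequality for each coordinate, hence is a homothet of \<open>K\<close>;
  its ratio is the sum of the bounds.
\<close>

lemma overlap_of_simplex: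
  assumes V: "finite V" "K = convex hull V" and f: "\<And>v. linear (f v)"
    "\<forall>v\<in>V. \<forall>u\<in>V. f v (u, 1) = (if u = v then 1 else 0)"
    "\<And>z. (\<Sum>v\<in>V. f v z *\<^sub>R (v, 1)) = z"
  defines "h \<equiv> coordinate_loss V f"
  shows "\<And>s z. 0 \<le> s \<Longrightarrow> h (s *\<^sub>R z) = s * h z"
    and "\<And>z. h z \<le> 0"
    and "\<And>z. \<exists>c. overlap K z = (if 0 \<le> 1/2 + h z then (\<lambda>k. c + (1/2 + h z) *\<^sub>R k) ` K else {})"
proof -
  note h_def = h_def coordinate_loss_def
  have tot: "(\<Sum>v\<in>V. f v z) = snd z" for z using arg_cong[OF f(3)[of z], of snd] by (simp add: snd_sum)
  show "h (s *\<^sub>R z) = s * h z" if "0 \<le> s" for s z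
  proof -
    have "f v (0, - snd (s *\<^sub>R z)) = s * f v (0, - snd z)" "f v (- fst (s *\<^sub>R z), snd (s *\<^sub>R z)) = s * f v (- fst z, snd z)" for v
      using linear_cmul[OF f(1), of v s "(0, - snd z)"] linear_cmul[OF f(1), of v s "(- fst z, snd z)"] by simp_all
    then show ?thesis using that by (simp add: h_def sum_distrib_left min_mult_distrib_left)
  qed
  show "h z \<le> 0" for z
  proof -
    have "h z \<le> (\<Sum>v\<in>V. f v (0, - snd z))" "h z \<le> (\<Sum>v\<in>V. f v (- fst z, snd z))"
      unfolding h_def by (intro sum_mono; simp)+
    then show ?thesis unfolding tot by simp
  qed
  show "\<exists>c. overlap K z = (if 0 \<le> 1/2 + h z then (\<lambda>k. c + (1/2 + h z) *\<^sub>R k) ` K else {})" for z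
  proof -
    define r where "r = (\<lambda>v. min (f v (0, 1/2 - snd z)) (f v (- fst z, 1/2 + snd z)))"
    define q where "q = (\<Sum>v\<in>V. r v *\<^sub>R (v, 1::real))"
    have split: "f v (x + x', t + t') = f v (x, t) + f v (x', t')" for v x x' t t'
      using linear_add[OF f(1), of v "(x, t)" "(x', t')"] by simp
    have r_eq: "r v = f v (0, 1/2) + min (f v (0, - snd z)) (f v (- fst z, snd z))" for v
      using split[of v 0 0 "1/2" "- snd z"] split[of v 0 "- fst z" "1/2" "snd z"] by (simp add: r_def)
    have sq: "snd q = 1/2 + h z"
    proof -
      have "snd q = sum r V" by (simp add: q_def snd_sum)
      also have "\<dots> = 1/2 + h z" unfolding r_eq h_def sum.distrib tot by simp
      finally show ?thesis .
    qed
    have fq: "f w q = r w" if "w \<in> V" for w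
    proof -
      have "f w q = (\<Sum>v\<in>V. r v * f w (v, 1))"
        unfolding q_def linear_sum[OF f(1)] linear_cmul[OF f(1)] by simp
      also have "\<dots> = (\<Sum>v\<in>V. if v = w then r v else 0)" using f(2) that by (intro sum.cong) auto
      finally show ?thesis using that V by simp
    qed
    have min_iff: "0 \<le> a + min p p' \<longleftrightarrow> 0 \<le> a + p \<and> 0 \<le> a + p'" for a p p' :: real
      by (auto simp: min_def)
    have "y \<in> overlap K z \<longleftrightarrow> (y, 0) + q \<in> Q" for y
    proof -
      have "f v (y, 1/2 - snd z) = f v (y, 0) + f v (0, 1/2 - snd z)"
        "f v (y - fst z, 1/2 + snd z) = f v (y, 0) + f v (- fst z, 1/2 + snd z)" for v
        using split[of v y 0 0 "1/2 - snd z"] split[of v y "- fst z" 0 "1/2 + snd z"] by simp_all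
      then have "y \<in> overlap K z \<longleftrightarrow> (\<forall>v\<in>V. 0 \<le> f v (y, 0) + r v)"
        unfolding overlap_def mem_Collect_eq cone_over_simplex_iff[OF V f] r_def min_iff
        by (simp add: ball_conj_distrib)
      also have "\<dots> \<longleftrightarrow> (\<forall>v\<in>V. 0 \<le> f v ((y, 0) + q))"
        by (simp add: linear_add[OF f(1)] fq)
      finally show ?thesis unfolding cone_over_simplex_iff[OF V f] .
    qed
    then have "y \<in> overlap K z \<longleftrightarrow> 0 \<le> 1/2 + h z \<and> (\<exists>k\<in>K. y = - fst q + (1/2 + h z) *\<^sub>R k)" for y
      by (cases q) (use sq in \<open>auto simp: cone_over_iff algebra_simps eq_neg_iff_add_eq_0\<close>)
    then show ?thesis by (intro exI[of _ "- fst q"]) auto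
  qed
qed

lemma simplexE:
  assumes "int DIM('a) simplex K"
  obtains V and f :: "'a \<Rightarrow> 'a \<times> real \<Rightarrow> real" where "finite V" "K = convex hull V" "\<And>v. linear (f v)"
    "\<forall>v\<in>V. \<forall>u\<in>V. f v (u, 1) = (if u = v then 1 else 0)"
    "\<And>z. (\<Sum>v\<in>V. f v z *\<^sub>R (v, 1)) = z"
proof -
  obtain V where V: "\<not> affine_dependent V" "int (card V) = int DIM('a) + 1" "K = convex hull V"
    using assms unfolding simplex_def by auto
  have "card V = DIM('a) + 1" using V(2) by linarith
  show ?thesis
    by (rule lifted_barycentric_coordinates[OF V(1) \<open>card V = DIM('a) + 1\<close>])
      (rule that[OF aff_independent_finite[OF V(1)] V(3)])
qed

text \<open>
  The relative overlap volume is the \<open>n\<close>-th power of the positive part of a function that is affine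
  on rays from the origin, and the body is where this function is nonnegative. So its level sets are
  dilates of the body.
\<close>

lemma rs_body_volume_simplex:
  assumes "int DIM('a) simplex K"
  shows "emeasure lborel (rs_body K) = ennreal (2 ^ DIM('a) / (real DIM('a) + 1)) * ennreal vol_K"
proof -
  obtain V f where Vf: "finite V" "K = convex hull V" "\<And>v. linear (f v :: 'a \<times> real \<Rightarrow> real)"
    "\<forall>v\<in>V. \<forall>u\<in>V. f v (u, 1) = (if u = v then 1 else 0)"
    "\<And>z. (\<Sum>v\<in>V. f v z *\<^sub>R (v, 1)) = z"
    by (rule simplexE[OF assms]) (rule that)
  define h where "h = coordinate_loss V f"
  note h = overlap_of_simplex[OF Vf, folded h_def]
  let ?F = "\<lambda>z. measure lborel (overlap K z)"
  have F0: "?F 0 > 0" using vol_K_pos by (simp add: overlap_volume_0)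
  have F: "?F z / ?F 0 = (max 0 (1 + 2 * h z)) ^ DIM('a)" for z
  proof -
    obtain c where c: "overlap K z = (if 0 \<le> 1/2 + h z then (\<lambda>k. c + (1/2 + h z) *\<^sub>R k) ` K else {})"
      using h(3) by blast
    have "?F z = (max 0 (1/2 + h z)) ^ DIM('a) * vol_K"
    proof (cases "0 \<le> 1/2 + h z")
      case True
      then show ?thesis using c measure_affine_image[OF True, of c] by (simp add: max_def)
    qed (use c in \<open>auto simp: max_def power_0_left\<close>)
    moreover have "max 0 (1 + 2 * h z) = 2 * max 0 (1/2 + h z)" by (simp add: max_def)
    ultimately show ?thesis using vol_K_pos by (simp add: overlap_volume_0 power_mult_distrib field_simps power_divide)
  qed
  have body: "rs_body K = {z. 0 \<le> 1 - (- 2 * h z)}"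
  proof -
    have "overlap K z \<noteq> {} \<longleftrightarrow> 0 \<le> 1 - (- 2 * h z)" for z
      using h(3)[of z] zero_K by auto
    then show ?thesis by (auto simp: rs_body_def)
  qed
  have "(\<integral>\<^sup>+z. ennreal (?F z / ?F 0) \<partial>lborel)
      = ennreal (1 / real ((DIM('a) + DIM('a \<times> real)) choose DIM('a))) * emeasure lborel (rs_body K)"
  proof (rule nn_integral_eq_of_concentric_levels)
    show "?F z / ?F 0 \<le> 1" for z unfolding F using h(2)[of z] by (intro power_le_one) auto
    show "{z. v ^ DIM('a) \<le> ?F z / ?F 0} = (*\<^sub>R) (1 - v) ` rs_body K" if "0 < v" "v < 1" for v
    proof -
      have "v ^ DIM('a) \<le> ?F z / ?F 0 \<longleftrightarrow> v \<le> 1 - (- 2 * h z)" for z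
        unfolding F using that DIM_positive[where 'a='a] by (subst power_mono_iff) auto
      then show ?thesis
        unfolding body using that by (subst homogeneous_levels[symmetric]) (auto simp: h(1))
    qed
  qed (use overlap_volume_measurable compact_rs_body F0 in \<open>auto simp: borel_compact DIM_positive Suc_le_eq\<close>)
  moreover have "(\<integral>\<^sup>+z. ennreal (?F z / ?F 0) \<partial>lborel) = ennreal (1 / real ((DIM('a) + Suc DIM('a)) choose DIM('a)))
      * (ennreal (2 ^ DIM('a) / (real DIM('a) + 1)) * ennreal vol_K)"
  proof -
    have "(\<integral>\<^sup>+z. ennreal (?F z / ?F 0) \<partial>lborel) = (\<integral>\<^sup>+z. ennreal (?F z) \<partial>lborel) * ennreal (1 / ?F 0)"
      using overlap_volume_measurable F0 by (subst nn_integral_multc[symmetric]) (auto simp: ennreal_mult[symmetric])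
    also have "\<dots> = ennreal (vol_K * (fact DIM('a) * fact DIM('a) / fact (2 * DIM('a) + 1)) * vol_K * (1 / ?F 0))"
      unfolding overlap_volume_integral_lborel using F0 by (subst ennreal_mult[symmetric]) auto
    also have "vol_K * (fact DIM('a) * fact DIM('a) / fact (2 * DIM('a) + 1)) * vol_K * (1 / ?F 0)
        = 1 / real ((DIM('a) + Suc DIM('a)) choose DIM('a)) * (2 ^ DIM('a) / (real DIM('a) + 1) * vol_K)"
      unfolding central_beta_eq overlap_volume_0 using vol_K_pos by (simp add: field_simps power_divide)
    finally show ?thesis by (simp add: ennreal_mult[symmetric])
  qed
  ultimately show ?thesis
    by (simp add: ennreal_mult_cancel_left ennreal_zero_less_divide)
qed

text \<open>
  Since the vertex \<open>0\<close> has coordinate one at \<open>(0, 1)\<close> and the other coordinates vanish there, the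
  height enters only one of the minima, and the fibres are explicit intervals of length \<open>1 - g\<close>
  with \<open>g\<close> positively homogeneous.
\<close>

lemma symm_hull_volume_simplex_vertex:
  assumes K: "int DIM('a) simplex K" and 0: "0 extreme_point_of K"
  shows "emeasure lborel symm_hull = ennreal (real DIM('a) + 1) * emeasure lborel (rs_body K)"
proof -
  obtain V f where Vf: "finite V" "K = convex hull V" "\<And>v. linear (f v :: 'a \<times> real \<Rightarrow> real)"
    "\<forall>v\<in>V. \<forall>u\<in>V. f v (u, 1) = (if u = v then 1 else 0)"
    "\<And>z. (\<Sum>v\<in>V. f v z *\<^sub>R (v, 1)) = z"
    by (rule simplexE[OF K]) (rule that)
  have V0: "0 \<in> V" using 0 Vf(2) extreme_point_of_convex_hull by blast
  define h where "h = coordinate_loss V f"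
  note h = overlap_of_simplex[OF Vf, folded h_def]
  define A where "A = (\<lambda>x. - (\<Sum>v\<in>V - {0}. min 0 (f v (- x, 0))))"
  define b where "b = (\<lambda>x. f 0 (- x, 0))"
  define g where "g = (\<lambda>x. 2 * A x - b x)"
  have tot: "(\<Sum>v\<in>V. f v z) = snd z" for z using arg_cong[OF Vf(5)[of z], of snd] by (simp add: snd_sum)
  have ax: "f v (0, t) = (if v = 0 then t else 0)" if "v \<in> V" for v t
    using linear_cmul[OF Vf(3), of v t "(0, 1)"] Vf(4) that V0 by simp
  have hx: "h (x, t) = min (- t) (b x + t) - A x" for x t
  proof -
    have sp: "f v (- x, t) = f v (- x, 0) + f v (0, t)" for v
      using linear_add[OF Vf(3), of v "(- x, 0)" "(0, t)"] by simp
    have "h (x, t) = (\<Sum>v\<in>V. min (f v (0, - t)) (f v (- x, t)))" by (simp add: h_def coordinate_loss_def)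
    also have "\<dots> = min (f 0 (0, - t)) (f 0 (- x, t)) + (\<Sum>v\<in>V - {0}. min (f v (0, - t)) (f v (- x, t)))"
      by (rule sum.remove[OF Vf(1) V0])
    also have "(\<Sum>v\<in>V - {0}. min (f v (0, - t)) (f v (- x, t))) = (\<Sum>v\<in>V - {0}. min 0 (f v (- x, 0)))"
      by (intro sum.cong) (auto simp: sp ax)
    finally show ?thesis using V0 by (simp add: sp ax A_def b_def)
  qed
  have fibre: "Pair x -` rs_body K = {A x - 1/2 - b x .. 1/2 - A x}" for x
  proof -
    have "(x, t) \<in> rs_body K \<longleftrightarrow> 0 \<le> 1/2 + h (x, t)" for t
      using h(3)[of "(x, t)"] zero_K by (auto simp: rs_body_def)
    then show ?thesis by (auto simp: hx min_def split: if_splits)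
  qed
  have len: "measure lborel (Pair x -` rs_body K) = max 0 (1 - g x)" for x
    unfolding fibre by (simp add: g_def max_def)
  have g_hom: "g (s *\<^sub>R x) = s * g x" if "0 \<le> s" for s x
  proof -
    have "f v (- (s *\<^sub>R x), 0) = s * f v (- x, 0)" for v
      using linear_cmul[OF Vf(3), of v s "(- x, 0)"] by simp
    moreover have "min 0 (s * u) = s * min 0 u" for u using min_mult_distrib_left[of s 0 u] that by simp
    ultimately have "A (s *\<^sub>R x) = s * A x" "b (s *\<^sub>R x) = s * b x"
      by (simp_all add: A_def b_def sum_distrib_left)
    then show ?thesis by (simp add: g_def right_diff_distrib)
  qed
  have g_nonneg: "0 \<le> g x" for x
  proof -
    have "b x + (\<Sum>v\<in>V - {0}. f v (- x, 0)) = 0"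
      using tot[of "(- x, 0)"] sum.remove[OF Vf(1) V0, of "\<lambda>v. f v (- x, 0)"] by (simp add: b_def)
    moreover have "(\<Sum>v\<in>V - {0}. min 0 (f v (- x, 0))) \<le> (\<Sum>v\<in>V - {0}. f v (- x, 0))"
      "(\<Sum>v\<in>V - {0}. min 0 (f v (- x, 0))) \<le> 0"
      by (intro sum_mono sum_nonpos; simp)+
    ultimately show ?thesis by (simp add: g_def A_def)
  qed
  have hull: "symm_hull = {x. 0 \<le> 1 - g x}"
  proof -
    have "x \<in> fst ` rs_body K \<longleftrightarrow> Pair x -` rs_body K \<noteq> {}" for x by force
    then have "x \<in> fst ` rs_body K \<longleftrightarrow> 0 \<le> 1 - g x" for x unfolding fibre by (auto simp: g_def)
    then show ?thesis unfolding projection_rs_body[symmetric] by blast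
  qed
  have "(\<integral>\<^sup>+x. ennreal (measure lborel (Pair x -` rs_body K)) \<partial>lborel)
      = ennreal (1 / real ((1 + DIM('a)) choose 1)) * emeasure lborel symm_hull"
  proof (rule nn_integral_eq_of_concentric_levels)
    show "measure lborel (Pair x -` rs_body K) \<le> 1" for x unfolding len using g_nonneg[of x] by simp
    show "{x. v ^ 1 \<le> measure lborel (Pair x -` rs_body K)} = (*\<^sub>R) (1 - v) ` symm_hull" if "0 < v" "v < 1" for v
    proof -
      have "v ^ 1 \<le> measure lborel (Pair x -` rs_body K) \<longleftrightarrow> v \<le> 1 - g x" for x
        unfolding len using that by auto
      then show ?thesis unfolding hull using homogeneous_levels[OF g_hom that(2)] by auto
    qed
  qed (use rs_fibre_measurable compact_symm_hull in \<open>auto simp: borel_compact\<close>)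
  then have "emeasure lborel (rs_body K) = ennreal (1 / (real DIM('a) + 1)) * emeasure lborel symm_hull"
    using rs_body_measure_eq_fibres[OF radial_measure_lborel] by (simp add: lborel_prod add.commute)
  then show ?thesis by (simp add: mult.assoc[symmetric] ennreal_mult[symmetric] del: ennreal_plus)
qed

text \<open>
  If \<open>0\<close> is not extreme, \<open>K\<close> contains \<open>v\<close> and \<open>-v\<close> for some \<open>v \<noteq> 0\<close>, and the fibres over the
  segment from \<open>0\<close> to \<open>v\<close> have full length. Near \<open>v/2\<close> the length is still almost \<open>1\<close>, while
  \<open>v/2\<close> stays away from small dilates of the hull: a ball around \<open>v/2\<close> is a surplus.
\<close>

lemma extreme_point_of_symm_hull_equality:
  assumes eq: "ennreal (real DIM('a) + 1) * emeasure lborel (rs_body K) \<le> emeasure lborel symm_hull"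
  shows "0 extreme_point_of K"
proof (rule ccontr)
  assume "\<not> ?thesis"
  then obtain a b where ab: "a \<in> K" "b \<in> K" "0 \<in> open_segment a b"
    using zero_K by (auto simp: extreme_point_of_def)
  then obtain u where u: "0 < u" "u < 1" "0 = (1 - u) *\<^sub>R a + u *\<^sub>R b" "a \<noteq> b" by (auto simp: in_segment)
  define l where "l = (1 - u) / u"
  have l: "l > 0" using u by (simp add: l_def)
  have "u *\<^sub>R b = - ((1 - u) *\<^sub>R a)" using u(3) by (simp add: eq_neg_iff_add_eq_0 add.commute)
  then have "(1 / u) *\<^sub>R (u *\<^sub>R b) = (1 / u) *\<^sub>R (- ((1 - u) *\<^sub>R a))" by simp
  then have b: "b = - (l *\<^sub>R a)" using u by (simp add: l_def)
  have a0: "a \<noteq> 0" using u(4) b by auto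
  have shrink: "c *\<^sub>R x \<in> K" if "x \<in> K" "0 \<le> c" "c \<le> 1" for c x
    using convexD[OF convex_K that(1) zero_K, of c "1 - c"] that by simp
  have "\<exists>v. v \<noteq> 0 \<and> v \<in> K \<and> - v \<in> K"
  proof (cases "l \<ge> 1")
    case True
    then have "(1 / l) *\<^sub>R b \<in> K" using ab by (intro shrink) auto
    moreover have "(1 / l) *\<^sub>R b = - a" using l b by simp
    ultimately show ?thesis using a0 ab by (intro exI[of _ a]) auto
  next
    case False
    then have "l *\<^sub>R a \<in> K" using ab l by (intro shrink) auto
    then show ?thesis using a0 ab l b by (intro exI[of _ b]) auto
  qed
  then obtain v where v: "v \<noteq> 0" "v \<in> K" "- v \<in> K" by blast
  have full: "(r *\<^sub>R v, t) \<in> rs_body K" if "0 \<le> r" "r \<le> 1" "\<bar>t\<bar> \<le> 1/2" for r t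
  proof -
    have "r *\<^sub>R v \<in> K" "r *\<^sub>R (- v) \<in> K" using that v by (intro shrink; simp)+
    moreover have "r *\<^sub>R v = (1/2 - t) *\<^sub>R (r *\<^sub>R v) - (1/2 + t) *\<^sub>R (r *\<^sub>R (- v))"
      by (simp add: algebra_simps) (simp flip: scaleR_left_distrib)
    ultimately show ?thesis unfolding rs_body_iff using that(3) by blast
  qed
  obtain \<rho> where \<rho>: "\<rho> > 0" "ball 0 \<rho> \<subseteq> symm_hull" using zero_interior_symm_hull by (auto simp: mem_interior)
  obtain R where R: "R > 0" "\<And>z. z \<in> symm_hull \<Longrightarrow> norm z \<le> R"
    using compact_imp_bounded[OF compact_symm_hull] bounded_pos by metis
  (* The surplus is found at the levels from 1 - e/2 to 1 - e/4: the dilates of the hull by at most e/2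
     stay within norm v / 8 of the origin, and the fibres near v/2 are of length at least 1 - e/4. *)
  define e where "e = min (1/2) (norm v / (4 * R))"
  have e: "0 < e" "e \<le> 1/2" "e * R \<le> norm v / 4"
    using v R by (auto simp: e_def min_def field_simps)
  define \<delta> where "\<delta> = e / 4"
  have \<delta>: "0 < \<delta>" "\<delta> \<le> 1/2" using e by (auto simp: \<delta>_def)
  define r where "r = min (\<delta> * \<rho>) (norm v / 4)"
  have r: "r > 0" using \<delta> \<rho> v by (simp add: r_def)
  let ?U = "ball ((1/2) *\<^sub>R v) r"
  have len: "1 - \<delta> \<le> measure lborel (Pair x -` rs_body K)" if "x \<in> ?U" for x
  proof -
    define w where "w = (1 / \<delta>) *\<^sub>R (x - (1/2) *\<^sub>R v)"
    have "norm (x - (1/2) *\<^sub>R v) < \<delta> * \<rho>" using that by (simp add: r_def dist_norm norm_minus_commute)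
    moreover have "norm w = norm (x - (1/2) *\<^sub>R v) / \<delta>" using \<delta> unfolding w_def norm_scaleR by simp
    ultimately have "norm w < \<rho>" using \<delta> by (simp add: pos_divide_less_eq mult.commute)
    then have "w \<in> symm_hull" using \<rho> by auto
    then obtain t where t: "(w, t) \<in> rs_body K" by (auto simp: projection_rs_body[symmetric])
    have x: "x = (1 - \<delta>) *\<^sub>R ((1 / (2 * (1 - \<delta>))) *\<^sub>R v) + \<delta> *\<^sub>R w"
      using \<delta> by (simp add: w_def)
    have "{\<delta> * t - (1 - \<delta>) / 2 .. \<delta> * t + (1 - \<delta>) / 2} \<subseteq> Pair x -` rs_body K"
    proof
      fix q assume q: "q \<in> {\<delta> * t - (1 - \<delta>) / 2 .. \<delta> * t + (1 - \<delta>) / 2}"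
      define q' where "q' = (q - \<delta> * t) / (1 - \<delta>)"
      have "\<bar>q - \<delta> * t\<bar> \<le> (1 - \<delta>) / 2" using q by (intro abs_leI) (auto simp: field_simps)
      then have q': "\<bar>q'\<bar> \<le> 1/2" "q = (1 - \<delta>) * q' + \<delta> * t" using \<delta> by (simp_all add: q'_def abs_divide divide_le_eq)
      have "((1 / (2 * (1 - \<delta>))) *\<^sub>R v, q') \<in> rs_body K"
        using \<delta> q' by (intro full) (auto simp: field_simps)
      then have "(1 - \<delta>) *\<^sub>R ((1 / (2 * (1 - \<delta>))) *\<^sub>R v, q') + \<delta> *\<^sub>R (w, t) \<in> rs_body K"
        using t \<delta> by (intro convexD[OF convex_rs_body]) auto
      then show "q \<in> Pair x -` rs_body K" unfolding vimage_eq x q'(2) by simp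
    qed
    from rs_fibre_length_ge[OF this] show ?thesis by (simp add: field_simps)
  qed
  have far: "x \<notin> (*\<^sub>R) (1 - s) ` symm_hull" if "x \<in> ?U" "1 - e / 2 \<le> s" "s \<le> 1 - \<delta>" for x s
  proof
    assume "x \<in> (*\<^sub>R) (1 - s) ` symm_hull"
    then obtain c where c: "c \<in> symm_hull" "x = (1 - s) *\<^sub>R c" by auto
    have "norm x = (1 - s) * norm c" using c that \<delta> by simp
    also have "\<dots> \<le> (e / 2) * R" using that R(2)[OF c(1)] e by (intro mult_mono) auto
    also have "\<dots> \<le> norm v / 8" using e(3) by linarith
    finally have "norm x \<le> norm v / 8" .
    moreover have "norm ((1/2) *\<^sub>R v) \<le> norm x + norm ((1/2) *\<^sub>R v - x)"
      using norm_triangle_ineq[of x "(1/2) *\<^sub>R v - x"] by simp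
    moreover have "norm ((1/2) *\<^sub>R v - x) < norm v / 4" using that by (simp add: r_def dist_norm)
    moreover have "norm ((1/2) *\<^sub>R v) = norm v / 2" by simp
    moreover have "norm v > 0" using v by simp
    ultimately show False by linarith
  qed
  have "ennreal (1 / (real DIM('a) + 1)) * emeasure lborel symm_hull
      + ennreal ((1 - \<delta>) - (1 - e / 2)) * emeasure lborel ?U \<le> emeasure (lborel \<Otimes>\<^sub>M lborel) (rs_body K)"
  proof (rule symm_hull_measure_gap[OF radial_measure_lborel])
    show "s \<le> measure lborel (Pair x -` rs_body K) \<and> x \<notin> (*\<^sub>R) (1 - s) ` symm_hull"
      if "1 - e / 2 \<le> s" "s \<le> 1 - \<delta>" "x \<in> ?U" for s x
      using len[OF that(3)] far[OF that(3,1,2)] that by auto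
  qed (use e \<delta> in \<open>auto simp: \<delta>_def\<close>)
  moreover have "emeasure lborel (rs_body K) \<le> ennreal (1 / (real DIM('a) + 1)) * emeasure lborel symm_hull"
    using mult_left_mono[OF eq, of "ennreal (1 / (real DIM('a) + 1))"]
    by (simp add: mult.assoc[symmetric] ennreal_mult[symmetric] del: ennreal_plus)
  ultimately have "emeasure lborel (rs_body K) + ennreal ((1 - \<delta>) - (1 - e / 2)) * emeasure lborel ?U
      \<le> emeasure lborel (rs_body K) + 0"
    unfolding lborel_prod by (metis (no_types, lifting) add.right_neutral add_right_mono order_trans)
  then have "ennreal ((1 - \<delta>) - (1 - e / 2)) * emeasure lborel ?U \<le> 0"
    using emeasure_compact_finite[OF compact_rs_body] by (subst (asm) ennreal_add_left_cancel_le) auto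
  moreover have "emeasure lborel ?U > 0"
    using r content_ball_pos[of r "(1/2) *\<^sub>R v"] emeasure_lborel_ball_finite[of "(1/2) *\<^sub>R v" r]
    by (simp add: emeasure_eq_ennreal_measure)
  moreover have "(1 - \<delta>) - (1 - e / 2) > 0" using e by (simp add: \<delta>_def)
  ultimately show False by simp
qed

end

section \<open>Radially decreasing densities\<close>

text \<open>
  A radially decreasing density is bounded by its value at the origin. This makes the measure finite
  on bounded sets, as Fubini requires.
\<close>

locale radial_density = convex_body_with_origin K
  for K :: "'a::euclidean_space set" +
  fixes \<phi> :: "'a \<Rightarrow> real"
  assumes \<phi>_measurable: "\<phi> \<in> borel_measurable lebesgue"
    and \<phi>_nonneg: "0 \<le> \<phi> x"
    and \<phi>_radial: "0 \<le> t \<Longrightarrow> t \<le> 1 \<Longrightarrow> \<phi> x \<le> \<phi> (t *\<^sub>R x)"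
begin

abbreviation "\<mu> \<equiv> density lebesgue (\<lambda>x. ennreal (\<phi> x))"

text \<open>
  Restricted to the Borel sets, the measure forms products with Borel sets of \<open>\<real>\<^sup>n \<times> \<real>\<close>; all sets
  in the inequalities are compact.
\<close>

definition "borel_\<mu> = distr \<mu> borel (\<lambda>x. x)"

definition "reflected_copy y \<theta> = (\<lambda>x. (1 - \<theta>) *\<^sub>R y - \<theta> *\<^sub>R x) ` K"

definition "copy_sup = (SUP (y, \<theta>) \<in> K \<times> {0<..1}. emeasure \<mu> (reflected_copy y \<theta>) / ennreal (\<theta> ^ DIM('a)))"

definition "const_on_hull c \<longleftrightarrow>
   (\<forall>M\<in>sets lebesgue. M \<subseteq> symm_hull \<longrightarrow> emeasure \<mu> M = ennreal c * emeasure lebesgue M)"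

lemma \<phi>_ennreal_measurable [measurable]: "(\<lambda>x. ennreal (\<phi> x)) \<in> borel_measurable lebesgue"
  using \<phi>_measurable by measurable

lemma \<phi>_le: "\<phi> x \<le> \<phi> 0"
  using \<phi>_radial[of 0 x] by simp

lemma id_borel_measurable: "(\<lambda>x. x) \<in> measurable \<mu> borel"
  by (simp add: measurable_completion)

lemma emeasure_borel_\<mu>: "A \<in> sets borel \<Longrightarrow> emeasure borel_\<mu> A = emeasure \<mu> A"
  unfolding borel_\<mu>_def by (subst emeasure_distr[OF id_borel_measurable]) auto

lemma emeasure_\<mu>_le: "A \<in> sets borel \<Longrightarrow> emeasure \<mu> A \<le> ennreal (\<phi> 0) * emeasure lborel A"
proof -
  assume A: "A \<in> sets borel"
  have "emeasure \<mu> A = (\<integral>\<^sup>+x. ennreal (\<phi> x) * indicator A x \<partial>lebesgue)"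
    using A by (intro emeasure_density) auto
  also have "\<dots> \<le> (\<integral>\<^sup>+x. ennreal (\<phi> 0) * indicator A x \<partial>lebesgue)"
    using \<phi>_le by (intro nn_integral_mono mult_right_mono) (auto simp: ennreal_leI)
  also have "\<dots> = ennreal (\<phi> 0) * emeasure lborel A"
    using A by (subst nn_integral_cmult_indicator) auto
  finally show ?thesis .
qed

lemma lebesgue_scaleR:
  assumes "s > 0"
  shows "lebesgue = density (distr lebesgue lebesgue (\<lambda>x::'a. s *\<^sub>R x)) (\<lambda>_. ennreal (s ^ DIM('a)))"
    and "(\<lambda>x::'a. s *\<^sub>R x) \<in> lebesgue \<rightarrow>\<^sub>M lebesgue"
proof -
  have *: "(\<lambda>x::'a. 0 + (\<Sum>j\<in>Basis. (s * (x \<bullet> j)) *\<^sub>R j)) = (\<lambda>x. s *\<^sub>R x)"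
    by (auto simp: fun_eq_iff scaleR_scaleR[symmetric] scaleR_sum_right[symmetric] euclidean_representation simp del: scaleR_scaleR)
  show "lebesgue = density (distr lebesgue lebesgue (\<lambda>x::'a. s *\<^sub>R x)) (\<lambda>_. ennreal (s ^ DIM('a)))"
    using lebesgue_affine_euclidean[of "\<lambda>_. s" "0::'a"] assms unfolding * by simp
  show "(\<lambda>x::'a. s *\<^sub>R x) \<in> lebesgue \<rightarrow>\<^sub>M lebesgue"
    using lebesgue_affine_measurable[of "\<lambda>_. s" "0::'a"] assms unfolding * by simp
qed

text \<open>
  Substitute \<open>x = sy\<close> and use \<open>\<phi>(sy) \<ge> \<phi>(y)\<close>.
\<close>

lemma emeasure_\<mu>_scaleR:
  assumes A: "A \<in> sets borel" and s: "0 < s" "s \<le> 1"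
  shows "ennreal (s ^ DIM('a)) * emeasure \<mu> A \<le> emeasure \<mu> ((*\<^sub>R) s ` A)"
proof -
  note [measurable] = lebesgue_scaleR(2)[OF s(1)]
  have AL: "A \<in> sets lebesgue" "(*\<^sub>R) s ` A \<in> sets lebesgue"
    using A borel_scaleR_image[OF A] by auto
  have [measurable]: "(\<lambda>x. ennreal (\<phi> x) * indicator ((*\<^sub>R) s ` A) x) \<in> borel_measurable lebesgue"
    using AL by measurable
  have "ennreal (s ^ DIM('a)) * emeasure \<mu> A = ennreal (s ^ DIM('a)) * (\<integral>\<^sup>+x. ennreal (\<phi> x) * indicator A x \<partial>lebesgue)"
    using AL by (subst emeasure_density) auto
  also have "\<dots> \<le> ennreal (s ^ DIM('a)) * (\<integral>\<^sup>+x. ennreal (\<phi> (s *\<^sub>R x)) * indicator ((*\<^sub>R) s ` A) (s *\<^sub>R x) \<partial>lebesgue)"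
    using \<phi>_radial[of s] s by (intro mult_left_mono nn_integral_mono) (auto simp: indicator_def ennreal_leI)
  also have "\<dots> = (\<integral>\<^sup>+x. ennreal (\<phi> x) * indicator ((*\<^sub>R) s ` A) x
      \<partial>density (distr lebesgue lebesgue (\<lambda>x::'a. s *\<^sub>R x)) (\<lambda>_. ennreal (s ^ DIM('a))))"
  proof -
    have "(\<integral>\<^sup>+x. ennreal (\<phi> x) * indicator ((*\<^sub>R) s ` A) x
      \<partial>density (distr lebesgue lebesgue (\<lambda>x::'a. s *\<^sub>R x)) (\<lambda>_. ennreal (s ^ DIM('a))))
      = (\<integral>\<^sup>+x. ennreal (s ^ DIM('a)) * (ennreal (\<phi> x) * indicator ((*\<^sub>R) s ` A) x) \<partial>distr lebesgue lebesgue (\<lambda>x::'a. s *\<^sub>R x))"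
      by (rule nn_integral_density) auto
    also have "\<dots> = (\<integral>\<^sup>+x. ennreal (s ^ DIM('a)) * (ennreal (\<phi> (s *\<^sub>R x)) * indicator ((*\<^sub>R) s ` A) (s *\<^sub>R x)) \<partial>lebesgue)"
      by (rule nn_integral_distr) auto
    also have "\<dots> = ennreal (s ^ DIM('a)) * (\<integral>\<^sup>+x. ennreal (\<phi> (s *\<^sub>R x)) * indicator ((*\<^sub>R) s ` A) (s *\<^sub>R x) \<partial>lebesgue)"
      by (rule nn_integral_cmult) measurable
    finally show ?thesis by simp
  qed
  also have "\<dots> = emeasure \<mu> ((*\<^sub>R) s ` A)"
    using AL by (simp add: lebesgue_scaleR(1)[OF s(1), symmetric] emeasure_density)
  finally show ?thesis .
qed

lemma radial_measure_borel_\<mu>: "radial_measure borel_\<mu>"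
  unfolding radial_measure_def
proof (intro conjI ballI)
  show "sets borel_\<mu> = sets borel" by (simp add: borel_\<mu>_def)
  show "sigma_finite_measure borel_\<mu>"
  proof
    let ?A = "range (\<lambda>n::nat. ball (0::'a) (real n))"
    have "\<Union> ?A = (UNIV :: 'a set)"
      by (auto simp: reals_Archimedean2)
    moreover have "emeasure borel_\<mu> (ball 0 (real n)) \<noteq> \<infinity>" for n
    proof -
      have "emeasure borel_\<mu> (ball 0 (real n)) \<le> ennreal (\<phi> 0) * emeasure lborel (ball (0::'a) (real n))"
        by (simp add: emeasure_borel_\<mu> emeasure_\<mu>_le)
      also have "\<dots> < \<infinity>" using emeasure_lborel_ball_finite[of "0::'a"] by (simp add: ennreal_mult_less_top)
      finally show ?thesis by simp
    qed
    ultimately show "\<exists>A. countable A \<and> A \<subseteq> sets borel_\<mu> \<and> \<Union> A = space borel_\<mu> \<and> (\<forall>a\<in>A. emeasure borel_\<mu> a \<noteq> \<infinity>)"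
      by (intro exI[of _ ?A]) (auto simp: borel_\<mu>_def)
  qed
  show "ennreal (s ^ DIM('a)) * emeasure borel_\<mu> A \<le> emeasure borel_\<mu> ((*\<^sub>R) s ` A)"
    if "A \<in> sets borel" "s \<in> {0<..1}" for A s
    using that emeasure_\<mu>_scaleR[of A s] by (simp add: emeasure_borel_\<mu> borel_scaleR_image)
qed

lemma compact_reflected_copy: "compact (reflected_copy y \<theta>)"
  unfolding reflected_copy_def by (intro compact_continuous_image compact_K continuous_intros)

lemma volume_reflected_copy: "0 < \<theta> \<Longrightarrow> emeasure lborel (reflected_copy y \<theta>) = ennreal vol_K * ennreal (\<theta> ^ DIM('a))"
  unfolding reflected_copy_def by (rule reflected_copy_volume)

lemma reflected_copy_subset: "y \<in> K \<Longrightarrow> 0 < \<theta> \<Longrightarrow> \<theta> \<le> 1 \<Longrightarrow> reflected_copy y \<theta> \<subseteq> symm_hull"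
proof
  fix x assume *: "y \<in> K" "0 < \<theta>" "\<theta> \<le> 1" "x \<in> reflected_copy y \<theta>"
  then obtain k where k: "k \<in> K" "x = (1 - \<theta>) *\<^sub>R y - \<theta> *\<^sub>R k" by (auto simp: reflected_copy_def)
  have "(1 - \<theta>) *\<^sub>R y + \<theta> *\<^sub>R (- k) \<in> symm_hull"
    using * k by (intro convexD[OF convex_convex_hull]) (auto intro: hull_inc)
  then show "x \<in> symm_hull" by (simp add: k)
qed

lemma le_copy_sup:
  assumes "y \<in> K" "0 < \<theta>" "\<theta> \<le> 1"
  shows "emeasure \<mu> (reflected_copy y \<theta>) \<le> copy_sup * ennreal (\<theta> ^ DIM('a))"
proof -
  have "emeasure \<mu> (reflected_copy y \<theta>) / ennreal (\<theta> ^ DIM('a)) \<le> copy_sup"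
    unfolding copy_sup_def using assms by (intro SUP_upper2[of "(y, \<theta>)"]) auto
  then have "emeasure \<mu> (reflected_copy y \<theta>) / ennreal (\<theta> ^ DIM('a)) * ennreal (\<theta> ^ DIM('a))
      \<le> copy_sup * ennreal (\<theta> ^ DIM('a))" by (rule mult_right_mono) simp
  then show ?thesis using assms by (simp add: ennreal_divide_times divide_ennreal)
qed

abbreviation "rs_mass \<equiv> emeasure (borel_\<mu> \<Otimes>\<^sub>M lborel) (rs_body K)"

lemma rs_mass_le: "rs_mass \<le> ennreal (2 ^ DIM('a) / (real DIM('a) + 1)) * copy_sup"
proof (rule rs_body_measure_le[OF radial_measure_borel_\<mu>])
  fix y \<theta> assume *: "y \<in> K" "0 < \<theta>" "\<theta> \<le> (1::real)"
  have "emeasure borel_\<mu> (reflected_copy y \<theta>) = emeasure \<mu> (reflected_copy y \<theta>)"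
    using compact_reflected_copy by (intro emeasure_borel_\<mu> borel_compact)
  then show "emeasure borel_\<mu> ((\<lambda>x. (1 - \<theta>) *\<^sub>R y - \<theta> *\<^sub>R x) ` K) \<le> copy_sup * ennreal (\<theta> ^ DIM('a))"
    using le_copy_sup[OF *] by (simp add: reflected_copy_def)
qed

lemma symm_hull_\<mu>_le: "emeasure \<mu> symm_hull \<le> ennreal (real DIM('a) + 1) * rs_mass"
  using symm_hull_measure_le[OF radial_measure_borel_\<mu>] compact_symm_hull
  by (simp add: emeasure_borel_\<mu> borel_compact)

lemma dimension_constant: "ennreal (real DIM('a) + 1) * (ennreal (2 ^ DIM('a) / (real DIM('a) + 1)) * s) = 2 ^ DIM('a) * s"
proof -
  have "ennreal (real DIM('a) + 1) * ennreal (2 ^ DIM('a) / (real DIM('a) + 1)) = ennreal (2 ^ DIM('a))"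
    by (subst ennreal_mult[symmetric]) auto
  also have "\<dots> = 2 ^ DIM('a)" by (simp flip: ennreal_power)
  finally show ?thesis by (simp add: mult.assoc[symmetric] del: ennreal_plus)
qed

lemma symm_hull_\<mu>_le_copy_sup: "emeasure \<mu> symm_hull \<le> 2 ^ DIM('a) * copy_sup"
  using order_trans[OF symm_hull_\<mu>_le mult_left_mono[OF rs_mass_le]] by (simp only: dimension_constant zero_le)

lemma rs_mass_eq_slices:
  shows "(\<lambda>t. emeasure \<mu> {x. (x, t) \<in> rs_body K}) \<in> borel_measurable borel" (is ?measurable)
    and "rs_mass = (\<integral>\<^sup>+t. emeasure \<mu> {x. (x, t) \<in> rs_body K} \<partial>lborel)" (is ?mass)
proof -
  note m = radial_measureD[OF radial_measure_borel_\<mu>]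
  interpret M: sigma_finite_measure borel_\<mu> by (rule m(1))
  interpret P: pair_sigma_finite borel_\<mu> "lborel :: real measure" ..
  have "rs_body K \<in> sets (borel_\<mu> \<Otimes>\<^sub>M lborel)"
    using radial_measureD(2)[OF radial_measure_times_lborel[OF radial_measure_borel_\<mu>]] compact_rs_body
    by (simp add: borel_compact)
  note C = this
  have slice: "emeasure borel_\<mu> ((\<lambda>x. (x, t)) -` rs_body K) = emeasure \<mu> {x. (x, t) \<in> rs_body K}" for t
  proof -
    have "closed ((\<lambda>x. (x, t)) -` rs_body K)"
      by (intro continuous_closed_vimage compact_imp_closed compact_rs_body) (auto intro!: continuous_intros)
    then show ?thesis by (simp add: emeasure_borel_\<mu> vimage_def)
  qed
  show ?measurable using P.measurable_emeasure_Pair2[OF C] unfolding slice by simp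
  show ?mass using P.emeasure_pair_measure_alt2[OF C] unfolding slice .
qed

lemma rs_mass_eq_fibres:
  "rs_mass = (\<integral>\<^sup>+x. ennreal (\<phi> x) * ennreal (measure lborel (Pair x -` rs_body K)) \<partial>lebesgue)"
proof -
  have len: "(\<lambda>x. ennreal (measure lborel (Pair x -` rs_body K))) \<in> borel_measurable borel"
    using rs_fibre_measurable by simp
  then have len': "(\<lambda>x. ennreal (measure lborel (Pair x -` rs_body K))) \<in> borel_measurable lebesgue"
    by (simp add: measurable_completion)
  have "rs_mass = (\<integral>\<^sup>+x. ennreal (measure lborel (Pair x -` rs_body K)) \<partial>borel_\<mu>)"
    by (rule rs_body_measure_eq_fibres[OF radial_measure_borel_\<mu>])
  also have "\<dots> = (\<integral>\<^sup>+x. ennreal (measure lborel (Pair x -` rs_body K)) \<partial>\<mu>)"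
    unfolding borel_\<mu>_def by (rule nn_integral_distr[OF id_borel_measurable]) (use len in simp)
  also have "\<dots> = (\<integral>\<^sup>+x. ennreal (\<phi> x) * ennreal (measure lborel (Pair x -` rs_body K)) \<partial>lebesgue)"
    by (rule nn_integral_density) (use len' in auto)
  finally show ?thesis .
qed

lemma rs_volume_eq_fibres:
  "emeasure lborel (rs_body K) = (\<integral>\<^sup>+x. ennreal (measure lborel (Pair x -` rs_body K)) \<partial>lebesgue)"
  using rs_body_measure_eq_fibres[OF radial_measure_lborel] by (simp add: lborel_prod nn_integral_completion)

text \<open>
  An interior point of the hull is a proper multiple \<open>sx\<close> of another point of the hull, so its fibre
  has length at least \<open>1 - s\<close>.
\<close>

lemma rs_fibre_pos: "x \<in> interior symm_hull \<Longrightarrow> 0 < measure lborel (Pair x -` rs_body K)"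
proof -
  assume "x \<in> interior symm_hull"
  then obtain e where e: "e > 0" "ball x e \<subseteq> symm_hull" by (auto simp: mem_interior)
  define d where "d = e / (2 * (norm x + 1))"
  have d: "d > 0" using e by (simp add: d_def add_nonneg_pos)
  have "norm (d *\<^sub>R x) = e / 2 * (norm x / (norm x + 1))" using e by (simp add: d_def)
  also have "\<dots> \<le> e / 2 * 1"
    using e norm_ge_zero[of x] by (intro mult_left_mono) (simp_all add: divide_le_eq add_nonneg_pos)
  also have "\<dots> < e" using e by simp
  finally have "x + d *\<^sub>R x \<in> ball x e" by (simp add: dist_norm)
  then have "(1 + d) *\<^sub>R x \<in> symm_hull" using e by (auto simp: scaleR_left_distrib)
  then obtain t where t: "((1 + d) *\<^sub>R x, t) \<in> rs_body K" by (auto simp: projection_rs_body[symmetric])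
  have s: "0 \<le> 1 / (1 + d)" "1 / (1 + d) < 1" using d by auto
  have "(1 / (1 + d)) *\<^sub>R ((1 + d) *\<^sub>R x) = x" using d by simp
  then have "1 - 1 / (1 + d) \<le> measure lborel (Pair x -` rs_body K)"
    using rs_fibre_length_ge[OF rs_fibre_scaleR[OF t s(1)]] s by (simp add: field_simps)
  then show ?thesis using s by linarith
qed

text \<open>
  The mass is the integral of \<open>\<phi>\<close> against the fibre length. If replacing \<open>\<phi>\<close> by its upper bound
  \<open>\<phi>(0)\<close> does not increase the integral, then \<open>\<phi> = \<phi>(0)\<close> almost everywhere where the fibre length
  is positive, which is everywhere up to the boundary of the hull.
\<close>

lemma const_on_hull_of_full_mass:
  assumes "ennreal (\<phi> 0) * emeasure lborel (rs_body K) \<le> rs_mass"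
  shows "const_on_hull (\<phi> 0)"
  unfolding const_on_hull_def
proof (intro ballI impI)
  fix M :: "'a set"
  assume M: "M \<in> sets lebesgue" "M \<subseteq> symm_hull"
  let ?l = "\<lambda>x. measure lborel (Pair x -` rs_body K)"
  have [measurable]: "?l \<in> borel_measurable lebesgue" using rs_fibre_measurable by (simp add: measurable_completion)
  note [measurable] = \<phi>_measurable
  have nn: "0 \<le> ?l x" for x by (rule measure_nonneg)
  have fin: "rs_mass < \<infinity>"
  proof -
    have "rs_mass \<le> (\<integral>\<^sup>+x. ennreal (\<phi> 0) * ennreal (?l x) \<partial>lebesgue)"
      unfolding rs_mass_eq_fibres using \<phi>_le by (intro nn_integral_mono mult_right_mono) (auto simp: ennreal_leI)
    also have "\<dots> = ennreal (\<phi> 0) * emeasure lborel (rs_body K)"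
      unfolding rs_volume_eq_fibres by (rule nn_integral_cmult) measurable
    also have "\<dots> < \<infinity>" using emeasure_compact_finite[OF compact_rs_body] by (simp add: ennreal_mult_less_top)
    finally show ?thesis .
  qed
  have "rs_mass + (\<integral>\<^sup>+x. ennreal (\<phi> 0 - \<phi> x) * ennreal (?l x) \<partial>lebesgue)
      = (\<integral>\<^sup>+x. ennreal (\<phi> x) * ennreal (?l x) + ennreal (\<phi> 0 - \<phi> x) * ennreal (?l x) \<partial>lebesgue)"
    unfolding rs_mass_eq_fibres by (intro nn_integral_add[symmetric]) measurable
  also have "\<dots> = (\<integral>\<^sup>+x. ennreal (\<phi> 0) * ennreal (?l x) \<partial>lebesgue)"
  proof (intro nn_integral_cong)
    fix x
    have "ennreal (\<phi> x) + ennreal (\<phi> 0 - \<phi> x) = ennreal (\<phi> 0)"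
      using \<phi>_nonneg[of x] \<phi>_le[of x] by (simp flip: ennreal_plus)
    then show "ennreal (\<phi> x) * ennreal (?l x) + ennreal (\<phi> 0 - \<phi> x) * ennreal (?l x) = ennreal (\<phi> 0) * ennreal (?l x)"
      by (simp flip: distrib_right)
  qed
  also have "\<dots> = ennreal (\<phi> 0) * emeasure lborel (rs_body K)"
    unfolding rs_volume_eq_fibres by (rule nn_integral_cmult) measurable
  also have "\<dots> \<le> rs_mass + 0" using assms by simp
  finally have "(\<integral>\<^sup>+x. ennreal (\<phi> 0 - \<phi> x) * ennreal (?l x) \<partial>lebesgue) = 0"
    using fin by (subst (asm) ennreal_add_left_cancel_le) auto
  then have ae: "AE x in lebesgue. ennreal (\<phi> 0 - \<phi> x) * ennreal (?l x) = 0"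
    by (subst (asm) nn_integral_0_iff_AE) measurable
  have "negligible (frontier symm_hull)" by (intro negligible_convex_frontier convex_convex_hull)
  then have "AE x in lebesgue. x \<notin> frontier symm_hull"
    by (intro AE_not_in) (simp add: negligible_iff_null_sets)
  with ae have "AE x in lebesgue. ennreal (\<phi> x) * indicator M x = ennreal (\<phi> 0) * indicator M x"
  proof eventually_elim
    case (elim x)
    show ?case
    proof (cases "x \<in> M")
      case True
      then have "x \<in> interior symm_hull"
        using elim M compact_imp_closed[OF compact_symm_hull] by (auto simp: frontier_def)
      from rs_fibre_pos[OF this] elim(1) have "\<phi> 0 - \<phi> x \<le> 0" by (auto simp: ennreal_eq_0_iff)
      then show ?thesis using \<phi>_le[of x] by simp
    qed simp
  qed
  then have "(\<integral>\<^sup>+x. ennreal (\<phi> x) * indicator M x \<partial>lebesgue) = (\<integral>\<^sup>+x. ennreal (\<phi> 0) * indicator M x \<partial>lebesgue)"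
    by (rule nn_integral_cong_AE)
  then show "emeasure \<mu> M = ennreal (\<phi> 0) * emeasure lebesgue M"
    using M by (simp add: emeasure_density nn_integral_cmult_indicator)
qed

lemma rs_mass_le_volume: "rs_mass \<le> ennreal (\<phi> 0) * emeasure lborel (rs_body K)"
proof -
  have "rs_mass \<le> (\<integral>\<^sup>+x. ennreal (\<phi> 0) * ennreal (measure lborel (Pair x -` rs_body K)) \<partial>lebesgue)"
    unfolding rs_mass_eq_fibres using \<phi>_le by (intro nn_integral_mono mult_right_mono) (auto simp: ennreal_leI)
  also have "\<dots> = ennreal (\<phi> 0) * emeasure lborel (rs_body K)"
    unfolding rs_volume_eq_fibres using rs_fibre_measurable
    by (intro nn_integral_cmult) (simp add: measurable_completion)
  finally show ?thesis .
qed

lemma const_on_hullD: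
  "const_on_hull c \<Longrightarrow> M \<in> sets lebesgue \<Longrightarrow> M \<subseteq> symm_hull \<Longrightarrow> emeasure \<mu> M = ennreal c * emeasure lebesgue M"
  by (simp add: const_on_hull_def)

lemma copy_sup_const:
  assumes c: "const_on_hull c"
  shows "copy_sup = ennreal c * ennreal vol_K"
proof -
  have "emeasure \<mu> (reflected_copy y \<theta>) / ennreal (\<theta> ^ DIM('a)) = ennreal c * ennreal vol_K"
    if "y \<in> K" "0 < \<theta>" "\<theta> \<le> 1" for y \<theta>
  proof -
    have "emeasure \<mu> (reflected_copy y \<theta>) = ennreal c * emeasure lebesgue (reflected_copy y \<theta>)"
      using reflected_copy_subset[OF that] borel_compact[OF compact_reflected_copy]
      by (intro const_on_hullD[OF c]) auto
    also have "\<dots> = (ennreal c * ennreal vol_K) * ennreal (\<theta> ^ DIM('a))"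
      using borel_compact[OF compact_reflected_copy] volume_reflected_copy[OF that(2)] by (simp add: mult.assoc)
    finally show ?thesis using that by (simp add: mult_divide_eq_ennreal)
  qed
  then have "copy_sup = (SUP (y, \<theta>) \<in> K \<times> {0<..1::real}. ennreal c * ennreal vol_K)"
    unfolding copy_sup_def by (intro SUP_cong) auto
  also have "\<dots> = ennreal c * ennreal vol_K"
    using zero_K by (simp add: case_prod_unfold) (subst SUP_const; auto)
  finally show ?thesis .
qed

text \<open>
  The bound \<open>\<phi> \<le> \<phi>(0)\<close> gives one direction. For the other, the copies \<open>-\<theta>K\<close> shrink into
  neighbourhoods of the origin on which \<open>\<phi>\<close> is close to \<open>\<phi>(0)\<close>.
\<close>

lemma copy_sup_continuous:
  assumes "isCont \<phi> 0"
  shows "copy_sup = ennreal (\<phi> 0) * ennreal vol_K"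
proof (rule antisym)
  show "copy_sup \<le> ennreal (\<phi> 0) * ennreal vol_K"
    unfolding copy_sup_def
  proof (rule SUP_least, clarify)
    fix y \<theta> assume *: "y \<in> K" "\<theta> \<in> {0<..1::real}"
    have "emeasure \<mu> (reflected_copy y \<theta>) \<le> ennreal (\<phi> 0) * (ennreal vol_K * ennreal (\<theta> ^ DIM('a)))"
      using emeasure_\<mu>_le[OF borel_compact[OF compact_reflected_copy[of y \<theta>]]] *
      by (simp add: volume_reflected_copy)
    then have "emeasure \<mu> (reflected_copy y \<theta>) / ennreal (\<theta> ^ DIM('a))
        \<le> ennreal (\<phi> 0) * ennreal vol_K * ennreal (\<theta> ^ DIM('a)) / ennreal (\<theta> ^ DIM('a))"
      by (intro divide_right_mono_ennreal) (simp add: mult.assoc)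
    then show "emeasure \<mu> (reflected_copy y \<theta>) / ennreal (\<theta> ^ DIM('a)) \<le> ennreal (\<phi> 0) * ennreal vol_K"
      using * by (simp add: mult_divide_eq_ennreal)
  qed
  have "ennreal (\<phi> 0 * vol_K) \<le> copy_sup + ennreal e" if "0 < e" for e
  proof -
    define e' where "e' = e / vol_K"
    have e': "e' > 0" "e' * vol_K = e" using that vol_K_pos by (simp_all add: e'_def)
    obtain d where d: "d > 0" "\<And>x. norm x < d \<Longrightarrow> \<bar>\<phi> x - \<phi> 0\<bar> < e'"
      using assms e' unfolding continuous_at_eps_delta by (auto simp: dist_norm)
    obtain R where R: "R > 0" "\<And>k. k \<in> K \<Longrightarrow> norm k \<le> R"
      using compact_imp_bounded[OF compact_K] bounded_pos by metis
    define \<theta> where "\<theta> = min 1 (d / (2 * R))"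
    have \<theta>: "0 < \<theta>" "\<theta> \<le> 1" "\<theta> * R < d" using d R by (auto simp: \<theta>_def min_def field_simps)
    have small: "norm x < d" if x: "x \<in> reflected_copy 0 \<theta>" for x
    proof -
      obtain k where "k \<in> K" "x = - (\<theta> *\<^sub>R k)" using x by (auto simp: reflected_copy_def)
      then have "norm x \<le> \<theta> * R" using R \<theta> by (auto intro: mult_left_mono)
      then show ?thesis using \<theta> by simp
    qed
    have B: "reflected_copy 0 \<theta> \<in> sets lebesgue" "reflected_copy 0 \<theta> \<in> sets borel"
      using borel_compact[OF compact_reflected_copy] by auto
    have "ennreal (\<phi> 0 - e') * (ennreal vol_K * ennreal (\<theta> ^ DIM('a))) = (\<integral>\<^sup>+x. ennreal (\<phi> 0 - e') * indicator (reflected_copy 0 \<theta>) x \<partial>lebesgue)"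
      using B volume_reflected_copy[OF \<theta>(1)] by (simp add: nn_integral_cmult_indicator)
    also have "\<dots> \<le> (\<integral>\<^sup>+x. ennreal (\<phi> x) * indicator (reflected_copy 0 \<theta>) x \<partial>lebesgue)"
      using d(2) small by (intro nn_integral_mono) (force simp: indicator_def intro!: ennreal_leI)
    also have "\<dots> = emeasure \<mu> (reflected_copy 0 \<theta>)" using B by (simp add: emeasure_density)
    also have "\<dots> \<le> copy_sup * ennreal (\<theta> ^ DIM('a))" by (rule le_copy_sup[OF zero_K \<theta>(1,2)])
    finally have "ennreal (\<phi> 0 - e') * ennreal vol_K * ennreal (\<theta> ^ DIM('a)) / ennreal (\<theta> ^ DIM('a))
        \<le> copy_sup * ennreal (\<theta> ^ DIM('a)) / ennreal (\<theta> ^ DIM('a))"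
      by (intro divide_right_mono_ennreal) (simp add: mult.assoc)
    then have 1: "ennreal (\<phi> 0 - e') * ennreal vol_K \<le> copy_sup"
      using \<theta> by (simp add: mult_divide_eq_ennreal)
    have "ennreal (\<phi> 0) \<le> ennreal (\<phi> 0 - e') + ennreal e'"
      using e' \<phi>_nonneg[of 0] by (cases "e' \<le> \<phi> 0") (auto simp flip: ennreal_plus intro: ennreal_leI add_increasing)
    then have "ennreal (\<phi> 0) * ennreal vol_K \<le> (ennreal (\<phi> 0 - e') + ennreal e') * ennreal vol_K"
      by (rule mult_right_mono) simp
    also have "\<dots> = ennreal (\<phi> 0 - e') * ennreal vol_K + ennreal e"
      using e' vol_K_pos by (simp add: distrib_right ennreal_mult[symmetric] less_imp_le)
    also have "\<dots> \<le> copy_sup + ennreal e" using 1 by (rule add_right_mono)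
    finally show ?thesis using \<phi>_nonneg[of 0] vol_K_pos by (simp add: ennreal_mult)
  qed
  then have "ennreal (\<phi> 0 * vol_K) \<le> copy_sup" by (rule ennreal_le_epsilon)
  then show "ennreal (\<phi> 0) * ennreal vol_K \<le> copy_sup" using \<phi>_nonneg[of 0] vol_K_pos by (simp add: ennreal_mult)
qed

lemma rs_mass_const:
  assumes c: "const_on_hull c"
  shows "rs_mass = ennreal c * emeasure lborel (rs_body K)"
proof -
  have slice: "closed {x. (x, t) \<in> rs_body K}" for t
  proof -
    have "closed ((\<lambda>x. (x, t)) -` rs_body K)"
      by (intro continuous_closed_vimage compact_imp_closed compact_rs_body) (auto intro!: continuous_intros)
    then show ?thesis by (simp add: vimage_def)
  qed
  have sub: "{x. (x, t) \<in> rs_body K} \<subseteq> symm_hull" for t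
    unfolding projection_rs_body[symmetric] by force
  have K2: "rs_body K \<in> sets (lborel \<Otimes>\<^sub>M lborel)" unfolding lborel_prod using borel_compact[OF compact_rs_body] by simp
  have "rs_mass = (\<integral>\<^sup>+t. ennreal c * emeasure lborel {x. (x, t) \<in> rs_body K} \<partial>lborel)"
    unfolding rs_mass_eq_slices(2)
    using slice sub by (intro nn_integral_cong) (simp add: const_on_hullD[OF c])
  also have "\<dots> = ennreal c * (\<integral>\<^sup>+t. emeasure lborel {x. (x, t) \<in> rs_body K} \<partial>lborel)"
    using lborel_pair.measurable_emeasure_Pair2[OF K2] by (intro nn_integral_cmult) (simp add: vimage_def)
  also have "(\<integral>\<^sup>+t. emeasure lborel {x. (x, t) \<in> rs_body K} \<partial>lborel) = emeasure (lborel \<Otimes>\<^sub>M lborel) (rs_body K)"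
    using lborel_pair.emeasure_pair_measure_alt2[OF K2] by (simp add: vimage_def)
  finally show ?thesis by (simp add: lborel_prod)
qed

text \<open>
  The supremum and the bound \<open>\<phi> \<le> \<phi>(0)\<close> squeeze the mass between the two sides of the
  inequality for Lebesgue measure; \<open>\<phi>(0) > 0\<close> lets the density cancel.
\<close>

lemma rs_mass_equality_iff:
  assumes cont: "isCont \<phi> 0" and nz: "\<phi> x0 \<noteq> 0"
  shows "rs_mass = ennreal (2 ^ DIM('a) / (real DIM('a) + 1)) * copy_sup
    \<longleftrightarrow> (\<exists>c\<ge>0. const_on_hull c) \<and> int DIM('a) simplex K"
proof
  assume eq: "rs_mass = ennreal (2 ^ DIM('a) / (real DIM('a) + 1)) * copy_sup"
  have pos: "\<phi> 0 > 0" using nz \<phi>_le[of x0] \<phi>_nonneg[of x0] by linarith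
  have S: "copy_sup = ennreal (\<phi> 0) * ennreal vol_K" by (rule copy_sup_continuous[OF cont])
  have "ennreal (\<phi> 0) * (ennreal (2 ^ DIM('a) / (real DIM('a) + 1)) * ennreal vol_K) = rs_mass"
    unfolding eq S by (simp add: mult_ac)
  also have "\<dots> \<le> ennreal (\<phi> 0) * emeasure lborel (rs_body K)" by (rule rs_mass_le_volume)
  finally have vol: "ennreal (2 ^ DIM('a) / (real DIM('a) + 1)) * ennreal vol_K \<le> emeasure lborel (rs_body K)"
    using pos by (subst (asm) ennreal_mult_le_mult_iff) auto
  have simp: "int DIM('a) simplex K"
    by (rule simplex_of_cone_joins) (rule cone_join_of_equality[OF vol])
  have "ennreal (\<phi> 0) * emeasure lborel (rs_body K) \<le> rs_mass"
    unfolding rs_body_volume_simplex[OF simp] eq S by (simp add: mult_ac)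
  from const_on_hull_of_full_mass[OF this] have "\<exists>c\<ge>0. const_on_hull c"
    using \<phi>_nonneg[of 0] by blast
  with simp show "(\<exists>c\<ge>0. const_on_hull c) \<and> int DIM('a) simplex K" by simp
next
  assume R: "(\<exists>c\<ge>0. const_on_hull c) \<and> int DIM('a) simplex K"
  then obtain c where c: "const_on_hull c" by blast
  show "rs_mass = ennreal (2 ^ DIM('a) / (real DIM('a) + 1)) * copy_sup"
    using R by (simp add: rs_mass_const[OF c] copy_sup_const[OF c] rs_body_volume_simplex mult_ac)
qed

text \<open>
  The second inequality is the first one composed with the fibre estimate, so equality means equality
  in both.
\<close>

lemma symm_hull_equality_iff:
  assumes cont: "isCont \<phi> 0" and nz: "\<phi> x0 \<noteq> 0"
  shows "emeasure \<mu> symm_hull = 2 ^ DIM('a) * copy_sup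
    \<longleftrightarrow> (\<exists>c\<ge>0. const_on_hull c) \<and> int DIM('a) simplex K \<and> 0 extreme_point_of K"
proof
  assume eq: "emeasure \<mu> symm_hull = 2 ^ DIM('a) * copy_sup"
  let ?n1 = "ennreal (real DIM('a) + 1)"
  have n1: "?n1 \<noteq> 0" "?n1 < top" by (simp_all add: add_nonneg_eq_0_iff)
  have "?n1 * (ennreal (2 ^ DIM('a) / (real DIM('a) + 1)) * copy_sup) \<le> ?n1 * rs_mass"
    using symm_hull_\<mu>_le unfolding eq dimension_constant .
  then have "ennreal (2 ^ DIM('a) / (real DIM('a) + 1)) * copy_sup \<le> rs_mass"
    using n1 by (subst (asm) ennreal_mult_le_mult_iff) auto
  then have "rs_mass = ennreal (2 ^ DIM('a) / (real DIM('a) + 1)) * copy_sup"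
    using rs_mass_le by (intro antisym)
  then have R: "\<exists>c\<ge>0. const_on_hull c" "int DIM('a) simplex K" using rs_mass_equality_iff[OF cont nz] by auto
  obtain c where c: "const_on_hull c" using R(1) by blast
  have "\<phi> 0 > 0" using nz \<phi>_le[of x0] \<phi>_nonneg[of x0] by linarith
  then have "copy_sup \<noteq> 0" using copy_sup_continuous[OF cont] vol_K_pos by simp
  then have c0: "ennreal c \<noteq> 0" using copy_sup_const[OF c] by auto
  have "ennreal c * (?n1 * emeasure lborel (rs_body K)) = 2 ^ DIM('a) * copy_sup"
    unfolding rs_body_volume_simplex[OF R(2)] copy_sup_const[OF c] dimension_constant by (simp add: mult_ac)
  also have "\<dots> = ennreal c * emeasure lborel symm_hull"
    unfolding eq[symmetric] using compact_symm_hull by (simp add: const_on_hullD[OF c] borel_compact)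
  finally have "?n1 * emeasure lborel (rs_body K) \<le> emeasure lborel symm_hull"
    using c0 by (simp add: ennreal_mult_cancel_left del: ennreal_plus)
  from extreme_point_of_symm_hull_equality[OF this] R
  show "(\<exists>c\<ge>0. const_on_hull c) \<and> int DIM('a) simplex K \<and> 0 extreme_point_of K" by simp
next
  assume R: "(\<exists>c\<ge>0. const_on_hull c) \<and> int DIM('a) simplex K \<and> 0 extreme_point_of K"
  then obtain c where c: "const_on_hull c" by blast
  have "emeasure \<mu> symm_hull = ennreal c * emeasure lborel symm_hull"
    using compact_symm_hull by (simp add: const_on_hullD[OF c] borel_compact)
  also have "\<dots> = ennreal c * (2 ^ DIM('a) * ennreal vol_K)"
    using R by (simp only: symm_hull_volume_simplex_vertex rs_body_volume_simplex dimension_constant)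
  also have "\<dots> = 2 ^ DIM('a) * copy_sup" by (simp add: copy_sup_const[OF c] mult_ac)
  finally show "emeasure \<mu> symm_hull = 2 ^ DIM('a) * copy_sup" .
qed

end

lemma (in convex_body_with_origin) slice_eq_comb:
  assumes "\<theta> \<in> {0..1}"
  shows "{x. (x, \<theta> - 1/2) \<in> rs_body K} = {(1 - \<theta>) *\<^sub>R a - \<theta> *\<^sub>R b |a b. a \<in> K \<and> b \<in> K}"
proof -
  have "\<bar>\<theta> - 1/2\<bar> \<le> 1/2" using assms by (intro abs_leI) auto
  then show ?thesis by (auto simp: rs_body_iff)
qed

theorem theorem1p2:
  fixes K :: "(real ^ 'n) set" and \<phi> :: "real ^ 'n \<Rightarrow> real" and \<mu> :: "(real ^ 'n) measure"
  assumes "convex_body K" and "0 \<in> K"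
    and "\<phi> \<in> borel_measurable lebesgue" and "\<And>x. \<phi> x \<ge> 0"
    and "radially_decreasing \<phi>"
    and "\<mu> = density lebesgue (\<lambda>x. ennreal (\<phi> x))"
  shows
    "(\<integral>\<^sup>+\<theta>\<in>{0..1}. emeasure \<mu> (minkowski_comb \<theta> K) \<partial>lborel)
        \<le> ennreal (2 ^ CARD('n) / (real CARD('n) + 1)) * sup_ratio \<mu> K
     \<and> emeasure \<mu> (convex hull (K \<union> uminus ` K)) \<le> 2 ^ CARD('n) * sup_ratio \<mu> K
     \<and> (isCont \<phi> 0 \<and> (\<exists>x. \<phi> x \<noteq> 0) \<longrightarrow>
          ((\<integral>\<^sup>+\<theta>\<in>{0..1}. emeasure \<mu> (minkowski_comb \<theta> K) \<partial>lborel)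
              = ennreal (2 ^ CARD('n) / (real CARD('n) + 1)) * sup_ratio \<mu> K
           \<longleftrightarrow> const_multiple_lebesgue_on \<mu> (convex hull (K \<union> uminus ` K))
               \<and> int CARD('n) simplex K)
          \<and> (emeasure \<mu> (convex hull (K \<union> uminus ` K)) = 2 ^ CARD('n) * sup_ratio \<mu> K
           \<longleftrightarrow> const_multiple_lebesgue_on \<mu> (convex hull (K \<union> uminus ` K))
               \<and> int CARD('n) simplex K \<and> 0 extreme_point_of K))"
proof -
  interpret radial_density K \<phi>
    using assms by unfold_locales (auto simp: convex_body_def radially_decreasing_def)
  note \<mu> = assms(6)
  have DIM: "DIM(real ^ 'n) = CARD('n)" by simp
  have sup: "sup_ratio \<mu> K = copy_sup"
    unfolding sup_ratio_def copy_sup_def reflected_copy_def \<mu> by simp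
  have const: "const_multiple_lebesgue_on \<mu> symm_hull \<longleftrightarrow> (\<exists>c\<ge>0. const_on_hull c)"
    unfolding const_multiple_lebesgue_on_def const_on_hull_def \<mu> by simp
  have slice: "emeasure \<mu> (minkowski_comb \<theta> K) * indicator {0..1} \<theta>
      = emeasure \<mu> {x. (x, \<theta> - 1/2) \<in> rs_body K}" for \<theta>
  proof (cases "\<theta> \<in> {0..1}")
    case True
    have "minkowski_comb \<theta> K = {x. (x, \<theta> - 1/2) \<in> rs_body K}"
      unfolding slice_eq_comb[OF True] minkowski_comb_def set_plus_def by auto
    then show ?thesis using True by simp
  next
    case False
    then have "{x. (x, \<theta> - 1/2) \<in> rs_body K} = {}" by (auto simp: rs_body_iff abs_le_iff)
    then show ?thesis using False by simp
  qed
  have [measurable]: "(\<lambda>t. emeasure \<mu> {x. (x, t) \<in> rs_body K}) \<in> borel_measurable borel"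
    unfolding \<mu> by (rule rs_mass_eq_slices(1))
  have "(\<integral>\<^sup>+\<theta>\<in>{0..1}. emeasure \<mu> (minkowski_comb \<theta> K) \<partial>lborel)
      = (\<integral>\<^sup>+\<theta>. emeasure \<mu> {x. (x, -1/2 + 1 * \<theta>) \<in> rs_body K} \<partial>lborel)"
    by (simp add: slice)
  also have "\<dots> = (\<integral>\<^sup>+t. emeasure \<mu> {x. (x, t) \<in> rs_body K} \<partial>lborel)"
    by (subst (2) nn_integral_real_affine[where c=1 and t="-1/2"]) simp_all
  also have "\<dots> = rs_mass" unfolding rs_mass_eq_slices(2) \<mu> ..
  finally have mass: "(\<integral>\<^sup>+\<theta>\<in>{0..1}. emeasure \<mu> (minkowski_comb \<theta> K) \<partial>lborel) = rs_mass" .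
  show ?thesis
    using rs_mass_le symm_hull_\<mu>_le_copy_sup rs_mass_equality_iff symm_hull_equality_iff
    unfolding mass sup const DIM \<mu>[symmetric] by blast
qed

end
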